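(* Let $d=p_1p_2\cdots p_m\ge 2$ be a positive square-free integer (with $p_1,\dots,p_m$ distinct primes) and let $N\ge 2$ be an integer. Then any irreducible $\mathbb{Z}_+$-module of $\mathbb{Z}[d^{1/N}]$ is isomorphic, as a $\mathbb{Z}_+$-module, to $L_N(c_1,\dots,c_N)$ for some positive divisors $c_1,\dots,c_N$ of $d$ with $c_1c_2\cdots c_N=d$. Consequently, $\mathbb{Z}[d^{1/N}]$ has exactly $N^{m-1}$ irreducible $\mathbb{Z}_+$-modules up to isomorphism.
   Context: $\mathbb{Z}_+$ denotes the set of non-negative integers. A unital $\mathbb{Z}_+$-ring is a unital domain $R$, free as a $\mathbb{Z}$-module with a fixed basis $\{x_1=1,x_2,\dots,x_n\}$ such that $x_ix_j=\sum_k c_{ij}^k x_k$ with all $c_{ij}^k\in\mathbb{Z}_+$. A $\mathbb{Z}_+$-module of $R$ is an $R$-module $M$ that is free over $\mathbb{Z}$ with a fixed finite nonempty basis $\{m_1,\dots,m_t\}$ (its $\mathbb{Z}_+$-basis; $t$ is the rank) such that $x_im_j=\sum_k a_{ij}^k m_k$ with all $a_{ij}^k\in\mathbb{Z}_+$. A $\mathbb{Z}_+$-submodule of $M$ is an $R$-submodule that is the $\mathbb{Z}$-span of a subset of $\{m_1,\dots,m_t\}$. $M$ is irreducible if it has no $\mathbb{Z}_+$-submodule other than $0$ and $M$. Two $\mathbb{Z}_+$-modules $M,M'$ of $R$ with bases $\{m_i\}_{i=1}^t$, $\{m'_i\}_{i=1}^t$ are isomorphic if there are an $R$-module homomorphism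 $\psi:M\to M'$ and a permutation $\sigma\in S_t$ with $\psi(m_i)=m'_{\sigma(i)}$ for all $i$. Roots $d^{1/N}$ are positive real roots, and $\mathbb{Z}[d^{1/N}]\subset\mathbb{R}$ is a $\mathbb{Z}_+$-ring with basis $1,d^{1/N},d^{2/N},\dots,d^{(N-1)/N}$. For positive integers $c_1,\dots,c_N$ with $c_1\cdots c_N=d$, let $v=\prod_{i=1}^{N-1}c_{N-i}^{i/N}=c_{N-1}^{1/N}\cdots c_2^{(N-2)/N}c_1^{(N-1)/N}\in\mathbb{R}$ and define $$L_N(c_1,\dots,c_N)=\mathbb{Z}\Big\langle v,\ \tfrac{1}{c_1}d^{1/N}v,\ \tfrac{1}{c_1c_2}d^{2/N}v,\ \dots,\ \tfrac{1}{c_1c_2\cdots c_{N-1}}d^{(N-1)/N}v\Big\rangle\subset\mathbb{R},$$ the free $\mathbb{Z}$-module on the displayed real numbers. This equals $\mathbb{Z}\langle c_{N-1}^{1/N}\cdots c_2^{(N-2)/N}c_1^{(N-1)/N},\ c_N^{1/N}\cdots c_3^{(N-2)/N}c_2^{(N-1)/N},\ \dots,\ c_{N-2}^{1/N}\cdots c_1^{(N-2)/N}c_N^{(N-1)/N}\rangle$ (cyclic shifts of the indices). The ring $\mathbb{Z}[d^{1/N}]$ acts by multiplication of real numbers, and the displayed generators form the $\mathbb{Z}_+$-basis. *)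

theory Defs
  imports Complex_Main "HOL-Algebra.Module" "HOL-Combinatorics.Permutations"
    "HOL-Computational_Algebra.Primes"
begin

definition zcomb :: "('a, 'c) ring_scheme \<Rightarrow> ('a \<Rightarrow> int) \<Rightarrow> 'a set \<Rightarrow> 'a" where
  "zcomb G a S = (\<Oplus>\<^bsub>G\<^esub>x\<in>S. [a x] \<cdot>\<^bsub>G\<^esub> x)"

definition zspan :: "('a, 'c) ring_scheme \<Rightarrow> 'a set \<Rightarrow> 'a set" where
  "zspan G S = {zcomb G a S |a. True}"

(* bs lists a basis of the additive group of G as a free Z-module.  Elements of G serve as the
   indices of their own coefficients, hence the requirement that bs be distinct. *)
definition zbasis :: "('a, 'c) ring_scheme \<Rightarrow> 'a list \<Rightarrow> bool" where
  "zbasis G bs \<longleftrightarrow>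
     distinct bs \<and> set bs \<subseteq> carrier G \<and> zspan G (set bs) = carrier G \<and>
     (\<forall>a. zcomb G a (set bs) = \<zero>\<^bsub>G\<^esub> \<longrightarrow> (\<forall>b\<in>set bs. a b = 0))"

(* Domains in HOL-Algebra are commutative and satisfy 1 \<noteq> 0. *)
definition zplus_ring :: "('r, 'c) ring_scheme \<Rightarrow> 'r list \<Rightarrow> bool" where
  "zplus_ring R xs \<longleftrightarrow>
     domain R \<and> zbasis R xs \<and> xs \<noteq> [] \<and> hd xs = \<one>\<^bsub>R\<^esub> \<and>
     (\<forall>x\<in>set xs. \<forall>y\<in>set xs. \<exists>c :: 'r \<Rightarrow> nat. x \<otimes>\<^bsub>R\<^esub> y = zcomb R (\<lambda>z. int (c z)) (set xs))"

(* The multiplication and unit fields inherited by a module record are irrelevant here. *)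
definition zplus_module ::
  "('r, 'c) ring_scheme \<Rightarrow> 'r list \<Rightarrow> ('r, 'a) module \<Rightarrow> 'a list \<Rightarrow> bool" where
  "zplus_module R xs M ms \<longleftrightarrow>
     zplus_ring R xs \<and> module R M \<and> zbasis M ms \<and> ms \<noteq> [] \<and>
     (\<forall>x\<in>set xs. \<forall>m\<in>set ms. \<exists>a :: 'a \<Rightarrow> nat. x \<odot>\<^bsub>M\<^esub> m = zcomb M (\<lambda>z. int (a z)) (set ms))"

definition zplus_submodule ::
  "('r, 'c) ring_scheme \<Rightarrow> ('r, 'a) module \<Rightarrow> 'a list \<Rightarrow> 'a set \<Rightarrow> bool" where
  "zplus_submodule R M ms H \<longleftrightarrow> submodule H R M \<and> (\<exists>S\<subseteq>set ms. H = zspan M S)"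

definition irreducible_zplus_module ::
  "('r, 'c) ring_scheme \<Rightarrow> 'r list \<Rightarrow> ('r, 'a) module \<Rightarrow> 'a list \<Rightarrow> bool" where
  "irreducible_zplus_module R xs M ms \<longleftrightarrow>
     zplus_module R xs M ms \<and>
     (\<forall>H. zplus_submodule R M ms H \<longrightarrow> H = {\<zero>\<^bsub>M\<^esub>} \<or> H = carrier M)"

definition zplus_isomorphic ::
  "('r, 'c) ring_scheme \<Rightarrow> 'r list \<Rightarrow> ('r, 'a) module \<Rightarrow> 'a list \<Rightarrow> ('r, 'b) module \<Rightarrow> 'b list \<Rightarrow> bool"
  where
  "zplus_isomorphic R xs M ms M' ms' \<longleftrightarrow>
     zplus_module R xs M ms \<and> zplus_module R xs M' ms' \<and> length ms = length ms' \<and>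
     (\<exists>\<psi> \<sigma>. \<psi> \<in> hom (add_monoid M) (add_monoid M') \<and>
        (\<forall>r\<in>carrier R. \<forall>m\<in>carrier M. \<psi> (r \<odot>\<^bsub>M\<^esub> m) = r \<odot>\<^bsub>M'\<^esub> \<psi> m) \<and>
        \<sigma> permutes {..<length ms} \<and>
        (\<forall>i<length ms. \<psi> (ms ! i) = ms' ! \<sigma> i))"

definition irreducible_zplus_modules ::
  "('r, 'c) ring_scheme \<Rightarrow> 'r list \<Rightarrow> (('r, 'a) module \<times> 'a list) set" where
  "irreducible_zplus_modules R xs = {(M, ms). irreducible_zplus_module R xs M ms}"

definition zplus_iso_rel ::
  "('r, 'c) ring_scheme \<Rightarrow> 'r list \<Rightarrow> (('r, 'a) module \<times> 'a list) rel" where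
  "zplus_iso_rel R xs = {((M, ms), (M', ms')). zplus_isomorphic R xs M ms M' ms'}"

definition root_ring :: "nat \<Rightarrow> nat \<Rightarrow> real ring" where
  "root_ring d N =
     \<lparr>carrier = {\<Sum>i\<le>n. real_of_int (a i) * root N (real d) ^ i |(n::nat) a. True},
      monoid.mult = (*), one = 1, zero = 0, add = (+)\<rparr>"

definition root_basis :: "nat \<Rightarrow> nat \<Rightarrow> real list" where
  "root_basis d N = map (\<lambda>i. root N (real d) ^ i) [0..<N]"

(* A sequence c_1, ..., c_N is a function of which only the values on {1..N} matter. *)
definition L_v :: "nat \<Rightarrow> (nat \<Rightarrow> nat) \<Rightarrow> real" where
  "L_v N c = (\<Prod>i=1..N-1. root N (real (c (N - i))) ^ i)"

definition L_gen :: "nat \<Rightarrow> (nat \<Rightarrow> nat) \<Rightarrow> nat \<Rightarrow> real" where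
  "L_gen N c k =
     1 / (\<Prod>i=1..k. real (c i)) * root N (real (\<Prod>i=1..N. c i)) ^ k * L_v N c"

definition L_module :: "nat \<Rightarrow> (nat \<Rightarrow> nat) \<Rightarrow> (real, real) module" where
  "L_module N c =
     \<lparr>carrier = {\<Sum>k<N. real_of_int (a k) * L_gen N c k |a. True},
      monoid.mult = (*), one = 1, zero = 0, add = (+), smult = (*)\<rparr>"

definition L_basis :: "nat \<Rightarrow> (nat \<Rightarrow> nat) \<Rightarrow> real list" where
  "L_basis N c = map (L_gen N c) [0..<N]"

end

theory Submission
  imports Defs "HOL-Library.Countable_Set"
    "HOL-Computational_Algebra.Fundamental_Theorem_Algebra"
    "HOL-Computational_Algebra.Squarefree"
begin

text \<open>
Write \<open>\<alpha>\<close> for the positive \<open>N\<close>-th root of \<open>d\<close>. Since \<open>\<alpha>\<close> and \<open>\<alpha> ^ (N - 1)\<close> both act on a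
\<open>\<int>\<^sub>+\<close>-module by nonnegative integer matrices whose product is the scalar \<open>d\<close>, no cancellation can
occur in that product, and this forces the matrix of \<open>\<alpha>\<close> to be monomial: \<open>\<alpha>\<close> sends each basis
element to a positive multiple of a single basis element, and it permutes the basis up to these
multiples (\<open>smult_monomial\<close>). The span of an orbit of this permutation is a submodule, so
irreducibility leaves only one orbit.

As \<open>\<alpha> ^ N\<close> is the scalar \<open>d\<close>, walking \<open>N\<close> steps along the orbit leads back to the start and
collects multipliers with product \<open>d\<close>. If the orbit closed up earlier, every multiplier would occur
at least twice among these \<open>N\<close> steps, and the square of a prime factor would divide \<open>d\<close>. Hence the
orbit has exactly \<open>N\<close> elements, and the module is described by a cyclic sequence of \<open>N\<close>
multipliers with product \<open>d\<close> (\<open>irreducible_presentation\<close>). Conversely such a sequence determines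
the module up to isomorphism (\<open>presentation_iso\<close>), is determined by it up to rotation
(\<open>presentation_unique\<close>), and is realised by the module \<open>L\<^sub>N\<close> (\<open>L_presentation\<close>).

The existence half needs a genuine \<open>\<int>\<close>-basis of real numbers, that is, the irreducibility of
\<open>X ^ N - d\<close>. The argument is by absolute values: all complex roots have absolute value \<open>\<alpha>\<close>, so
the constant coefficient of a factor of degree \<open>k\<close> gives an \<open>N\<close>-th power of a rational number
equal to \<open>d ^ k\<close>, which is impossible for \<open>0 < k < N\<close> (\<open>root_powers_independent\<close>).

For the count, a sequence of \<open>N\<close> factors with square-free product \<open>d\<close> is the same as a
placement of the \<open>m\<close> primes of \<open>d\<close> at \<open>N\<close> positions. Rotating the first prime to position \<open>0\<close>
selects one representative of each class and leaves the other \<open>m - 1\<close> primes free, whence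
\<open>N ^ (m - 1)\<close> classes.
\<close>

section \<open>Integral independence of the powers of a root\<close>

lemma map_poly_of_int_mult:
  "map_poly of_int (p * q) = (map_poly of_int p * map_poly of_int q :: 'a::{comm_ring_1,ring_char_0} poly)"
  by (rule poly_eqI) (simp add: coeff_map_poly coeff_mult)

lemma map_poly_of_int_add:
  "map_poly of_int (p + q) = (map_poly of_int p + map_poly of_int q :: 'a::{comm_ring_1,ring_char_0} poly)"
  by (rule poly_eqI) (simp add: coeff_map_poly)

text \<open>
An integer polynomial of least degree \<open>k\<close> vanishing at the root divides a multiple of \<open>X ^ N - d\<close>,
so each of its \<open>k\<close> complex roots \<open>z\<close> satisfies \<open>\<bar>z\<bar> ^ N = d\<close>. Comparing its constant and
leading coefficients \<open>u\<close> and \<open>w\<close> gives \<open>\<bar>u\<bar> ^ N = \<bar>w\<bar> ^ N * d ^ k\<close>, and the multiplicity of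
\<open>q\<close> on both sides shows that \<open>N\<close> divides \<open>k\<close>.
\<close>

lemma root_powers_independent:
  fixes a :: "nat \<Rightarrow> int" and d N q :: nat
  assumes q: "prime q" "multiplicity q d = 1" and d: "d > 0" and N: "N > 0"
    and sum0: "(\<Sum>i<N. of_int (a i) * root N (real d) ^ i) = 0"
    and i: "i < N"
  shows "a i = 0"
proof (rule ccontr)
  assume ai: "a i \<noteq> 0"
  define \<alpha> where "\<alpha> = complex_of_real (root N (real d))"
  define ev where "ev f z = poly (map_poly of_int f) z" for f and z :: complex
  have ev_mult: "ev (f * g) z = ev f z * ev g z" and ev_add: "ev (f + g) z = ev f z + ev g z" for f g z
    by (simp_all add: ev_def map_poly_of_int_mult map_poly_of_int_add)
  define f0 where "f0 = (\<Sum>i<N. monom (a i) i)"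
  have coeff_f0: "coeff f0 j = (if j < N then a j else 0)" for j
    by (auto simp: f0_def coeff_sum if_distrib[of "\<lambda>x. x = _"] sum.delta' cong: if_cong)
  have "f0 \<noteq> 0" using coeff_f0[of i] i ai by auto
  have deg_f0: "degree f0 < N"
    using N degree_lessI[of f0 N] coeff_f0 by (meson leD degree_lessI)
  have "ev f0 \<alpha> = (\<Sum>j\<le>degree f0. of_int (coeff f0 j) * \<alpha> ^ j)"
    by (simp add: ev_def poly_altdef degree_map_poly coeff_map_poly)
  also have "\<dots> = (\<Sum>j<N. of_int (coeff f0 j) * \<alpha> ^ j)"
    using deg_f0 by (intro sum.mono_neutral_left) (auto simp: coeff_eq_0)
  also have "\<dots> = of_real (\<Sum>j<N. of_int (a j) * root N (real d) ^ j)"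
    by (simp add: coeff_f0 \<alpha>_def)
  finally have ev_f0: "ev f0 \<alpha> = 0" using sum0 by simp
  define P where "P f \<longleftrightarrow> f \<noteq> 0 \<and> ev f \<alpha> = 0" for f
  have "P f0" using \<open>f0 \<noteq> 0\<close> ev_f0 by (simp add: P_def)
  then obtain f where f: "P f" and f_min: "\<And>g. P g \<Longrightarrow> degree f \<le> degree g"
    using ex_has_least_nat[of P f0 degree] by auto
  define k where "k = degree f"
  have kN: "k < N" using f_min[OF \<open>P f0\<close>] deg_f0 by (simp add: k_def)
  have f_nz: "f \<noteq> 0" and f_root: "ev f \<alpha> = 0" using f by (auto simp: P_def)
  have k0: "k > 0"
  proof (rule ccontr)
    assume "\<not> k > 0"
    then obtain c where "f = [:c:]" by (auto simp: k_def elim: degree_eq_zeroE)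
    with f_nz f_root show False by (simp add: ev_def map_poly_pCons)
  qed
  define g where "g = monom 1 N - [:int d:]"
  have ev_g: "ev g z = z ^ N - of_nat d" for z
  proof -
    have "map_poly of_int g = (monom 1 N - [:of_nat d:] :: complex poly)"
      by (rule poly_eqI) (simp add: g_def coeff_map_poly coeff_monom coeff_pCons split: nat.splits)
    thus ?thesis by (simp add: ev_def poly_monom)
  qed
  have \<alpha>N: "\<alpha> ^ N = of_nat d"
    using N by (simp add: \<alpha>_def flip: of_real_power)
  \<comment> \<open>Pseudo-division avoids passing to rational coefficients; minimality of \<open>k\<close>
    makes the remainder vanish.\<close>
  obtain b h r where b: "b \<noteq> 0" and div: "smult b g = f * h + r" and r: "r = 0 \<or> degree r < degree f"
    using pseudo_mod[OF f_nz, of g] by blast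
  have ev_div: "of_int b * ev g z = ev f z * ev h z + ev r z" for z
  proof -
    have "[:b:] * g = f * h + r" using div by simp
    hence "ev [:b:] z * ev g z = ev f z * ev h z + ev r z"
      by (metis ev_add ev_mult)
    thus ?thesis by (simp add: ev_def map_poly_pCons)
  qed
  have "ev r \<alpha> = 0" using ev_div[of \<alpha>] by (simp add: ev_g \<alpha>N f_root)
  hence "r = 0" using r f_min[of r] by (metis P_def not_le)
  hence ev_r: "ev r z = 0" for z by (simp add: ev_def)
  have root_norm: "norm z ^ N = d" if "ev f z = 0" for z
  proof -
    have "of_int b * (z ^ N - of_nat d) = 0"
      using ev_div[of z] by (simp only: that ev_r ev_g mult_zero_left add_0)
    hence "z ^ N = of_nat d" using b by simp
    thus ?thesis by (simp flip: norm_power)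
  qed
  define F where "F = (map_poly of_int f :: complex poly)"
  have degF: "degree F = k" by (simp add: F_def k_def degree_map_poly)
  obtain rt where rt: "smult (lead_coeff F) (\<Prod>i<k. [:-rt i, 1:]) = F"
    using complex_poly_decompose'[of F] degF by metis
  have lF: "lead_coeff F = of_int (lead_coeff f)"
    by (simp add: degF) (simp add: F_def k_def coeff_map_poly)
  have ev_F: "ev f z = lead_coeff F * (\<Prod>i<k. z - rt i)" for z
  proof -
    have "ev f z = poly (smult (lead_coeff F) (\<Prod>i<k. [:-rt i, 1:])) z"
      by (subst rt) (simp add: ev_def F_def)
    thus ?thesis by (simp add: poly_prod)
  qed
  have rtN: "norm (rt i) ^ N = d" if "i < k" for i
    by (rule root_norm) (use that in \<open>auto simp: ev_F\<close>)
  define u w where "u = nat \<bar>coeff f 0\<bar>" and "w = nat \<bar>lead_coeff f\<bar>"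
  have "real u = norm (ev f 0)"
    by (simp add: u_def ev_def poly_0_coeff_0 coeff_map_poly)
  also have "\<dots> = real w * (\<Prod>i<k. norm (rt i))"
    unfolding ev_F lF by (simp add: norm_mult w_def prod_norm[symmetric])
  finally have "real u ^ N = real w ^ N * (\<Prod>i<k. norm (rt i) ^ N)"
    by (simp add: power_mult_distrib prod_power_distrib)
  also have "(\<Prod>i<k. norm (rt i) ^ N) = real d ^ k" by (simp add: rtN)
  finally have "real (u ^ N) = real (w ^ N * d ^ k)" by simp
  hence eq: "u ^ N = w ^ N * d ^ k" by (simp only: of_nat_eq_iff)
  have w0: "w > 0" using f_nz by (simp add: w_def)
  hence u0: "u > 0" using eq d N by (cases u) (auto simp: zero_power)
  have "N * multiplicity q u = N * multiplicity q w + k"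
    using arg_cong[OF eq, of "multiplicity q"] q u0 w0 d
    by (simp add: prime_elem_multiplicity_mult_distrib prime_elem_multiplicity_power_distrib)
  hence "N dvd k" by (metis dvd_add_right_iff dvd_triv_left)
  with k0 kN show False by (auto dest: dvd_imp_le)
qed

section \<open>Integer combinations in abelian groups and modules\<close>

context abelian_group
begin

lemma zmult_closed [simp]: "x \<in> carrier G \<Longrightarrow> [(k::int)] \<cdot> x \<in> carrier G"
  using group.int_pow_closed[OF a_group, of x k] by (simp add: add_pow_def)

lemma zmult_add: "x \<in> carrier G \<Longrightarrow> [(k + l :: int)] \<cdot> x = [k] \<cdot> x \<oplus> [l] \<cdot> x"
  using group.int_pow_mult[OF a_group, of x k l] by (simp add: add_pow_def)

lemma zmult_zmult: "x \<in> carrier G \<Longrightarrow> [(k::int)] \<cdot> ([(l::int)] \<cdot> x) = [(k * l)] \<cdot> x"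
  using group.int_pow_pow[OF a_group, of x l k] by (simp add: add_pow_def mult.commute)

lemma zmult_distrib:
  "x \<in> carrier G \<Longrightarrow> y \<in> carrier G \<Longrightarrow> [(k::int)] \<cdot> (x \<oplus> y) = [k] \<cdot> x \<oplus> [k] \<cdot> y"
  using comm_group.int_pow_distrib[OF a_comm_group, of x y k] by (simp add: add_pow_def)

lemma zmult_zero [simp]: "[(0::int)] \<cdot> x = \<zero>" and zmult_of_zero [simp]: "[(k::int)] \<cdot> \<zero> = \<zero>"
  using group.int_pow_one[OF a_group, of k] by (simp_all add: add_pow_def)

lemma zmult_one: "x \<in> carrier G \<Longrightarrow> [(1::int)] \<cdot> x = x"
  using group.int_pow_1[OF a_group, of x] by (simp add: add_pow_def)

lemma zcomb_closed [simp]: "S \<subseteq> carrier G \<Longrightarrow> zcomb G a S \<in> carrier G"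
  unfolding zcomb_def by (intro finsum_closed) auto

lemma zcomb_cong: "S \<subseteq> carrier G \<Longrightarrow> (\<And>x. x \<in> S \<Longrightarrow> a x = b x) \<Longrightarrow> zcomb G a S = zcomb G b S"
  unfolding zcomb_def by (intro finsum_cong') auto

lemma zcomb_add:
  assumes "S \<subseteq> carrier G"
  shows "zcomb G (\<lambda>x. a x + b x) S = zcomb G a S \<oplus> zcomb G b S"
proof -
  have "zcomb G (\<lambda>x. a x + b x) S = (\<Oplus>x\<in>S. [a x] \<cdot> x \<oplus> [b x] \<cdot> x)"
    unfolding zcomb_def using assms by (intro finsum_cong') (auto simp: zmult_add subset_iff)
  also have "\<dots> = zcomb G a S \<oplus> zcomb G b S"
    unfolding zcomb_def using assms by (intro finsum_addf) auto
  finally show ?thesis .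
qed

lemma zcomb_zero: "S \<subseteq> carrier G \<Longrightarrow> zcomb G (\<lambda>x. 0) S = \<zero>"
  unfolding zcomb_def by (simp add: finsum_zero)

lemma zcomb_uminus:
  assumes "S \<subseteq> carrier G" shows "zcomb G (\<lambda>x. - a x) S = \<ominus> zcomb G a S"
proof -
  have "zcomb G (\<lambda>x. - a x) S \<oplus> zcomb G a S = \<zero>"
    using zcomb_add[OF assms, of "\<lambda>x. - a x" a] zcomb_zero[OF assms] by simp
  thus ?thesis using assms by (metis minus_equality zcomb_closed)
qed

lemma zcomb_scale:
  assumes "finite S" "S \<subseteq> carrier G"
  shows "[k] \<cdot> zcomb G a S = zcomb G (\<lambda>x. k * a x) S"
  using assms
proof (induction S)
  case empty
  then show ?case by (simp add: zcomb_def)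
next
  case (insert x S)
  then have "zcomb G b (insert x S) = [b x] \<cdot> x \<oplus> zcomb G b S" for b
    unfolding zcomb_def by (subst finsum_insert) auto
  moreover have "[k] \<cdot> ([a x] \<cdot> x) = [(k * a x)] \<cdot> x"
    using insert by (simp add: zmult_zmult)
  ultimately show ?case using insert by (simp add: zmult_distrib)
qed

lemma zcomb_single:
  assumes "finite S" "S \<subseteq> carrier G" "s \<in> S"
  shows "zcomb G (\<lambda>x. if x = s then k else 0) S = [k] \<cdot> s"
proof -
  have "zcomb G (\<lambda>x. if x = s then k else 0) S = (\<Oplus>x\<in>S. if s = x then [k] \<cdot> x else \<zero>)"
    unfolding zcomb_def using assms by (intro finsum_cong') auto
  also have "\<dots> = [k] \<cdot> s"
    using assms by (intro add.finprod_singleton) auto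
  finally show ?thesis .
qed

lemma finsum_zcomb:
  assumes "finite T" "finite S" "S \<subseteq> carrier G"
  shows "(\<Oplus>x\<in>T. [b x] \<cdot> zcomb G (A x) S) = zcomb G (\<lambda>z. \<Sum>x\<in>T. b x * A x z) S"
  using assms(1)
proof (induction T)
  case empty
  then show ?case using assms by (simp add: zcomb_zero)
next
  case (insert x T)
  have "(\<Oplus>x\<in>insert x T. [b x] \<cdot> zcomb G (A x) S) =
        [b x] \<cdot> zcomb G (A x) S \<oplus> zcomb G (\<lambda>z. \<Sum>x\<in>T. b x * A x z) S"
    using insert assms by (subst finsum_insert) auto
  also have "\<dots> = zcomb G (\<lambda>z. b x * A x z + (\<Sum>x\<in>T. b x * A x z)) S"
    using assms by (simp add: zcomb_scale zcomb_add)
  finally show ?case using insert by simp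
qed

lemma zbasis_unique:
  assumes "zbasis G ms" "zcomb G a (set ms) = zcomb G b (set ms)" "x \<in> set ms"
  shows "a x = b x"
proof -
  have S: "set ms \<subseteq> carrier G" using assms by (simp add: zbasis_def)
  have "zcomb G (\<lambda>x. a x + - b x) (set ms) = zcomb G a (set ms) \<oplus> \<ominus> zcomb G b (set ms)"
    using S zcomb_add[OF S, of a "\<lambda>x. - b x"] zcomb_uminus[OF S, of b] by simp
  also have "\<dots> = \<zero>" using assms(2) S by (simp add: r_neg)
  finally have "\<forall>x\<in>set ms. a x + - b x = 0" using assms(1) unfolding zbasis_def by blast
  thus ?thesis using assms(3) by simp
qed

lemma zbasis_expand:
  assumes "zbasis G ms" "x \<in> carrier G" obtains a where "x = zcomb G a (set ms)"
  using assms unfolding zbasis_def zspan_def by blast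

lemma zcomb_hom:
  assumes "abelian_group H" "\<psi> \<in> hom (add_monoid G) (add_monoid H)"
    and "finite S" "S \<subseteq> carrier G"
  shows "\<psi> (zcomb G a S) = (\<Oplus>\<^bsub>H\<^esub>x\<in>S. [a x] \<cdot>\<^bsub>H\<^esub> \<psi> x)"
proof -
  interpret H: abelian_group H by fact
  interpret h: group_hom "add_monoid G" "add_monoid H" \<psi>
    using assms(2) by (unfold_locales) (auto simp: hom_def)
  have pow: "\<psi> ([k] \<cdot> x) = [k] \<cdot>\<^bsub>H\<^esub> \<psi> x" if "x \<in> carrier G" for x and k :: int
    using h.hom_int_pow[of x k] that by (simp add: add_pow_def)
  have cl: "\<psi> x \<in> carrier H" if "x \<in> carrier G" for x
    using h.hom_closed[of x] that by simp
  show ?thesis using assms(3,4)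
  proof (induction S)
    case empty
    then show ?case using h.hom_one by (simp add: zcomb_def)
  next
    case (insert x S)
    then have "zcomb G a (insert x S) = [a x] \<cdot> x \<oplus> zcomb G a S"
      unfolding zcomb_def by (subst finsum_insert) auto
    hence "\<psi> (zcomb G a (insert x S)) = [a x] \<cdot>\<^bsub>H\<^esub> \<psi> x \<oplus>\<^bsub>H\<^esub> \<psi> (zcomb G a S)"
      using insert h.hom_mult[of "[a x] \<cdot> x" "zcomb G a S"] by (simp add: pow)
    also have "\<dots> = (\<Oplus>\<^bsub>H\<^esub>x\<in>insert x S. [a x] \<cdot>\<^bsub>H\<^esub> \<psi> x)"
      using insert by (subst H.finsum_insert) (auto simp: cl)
    finally show ?case .
  qed
qed

lemma zspanI: "zcomb G a S \<in> zspan G S"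
  unfolding zspan_def by blast

lemma zspan_closed: "S \<subseteq> carrier G \<Longrightarrow> zspan G S \<subseteq> carrier G"
  unfolding zspan_def by auto

lemma zspan_zero: "S \<subseteq> carrier G \<Longrightarrow> \<zero> \<in> zspan G S"
  using zspanI[of "\<lambda>_. 0" S] by (simp add: zcomb_zero)

lemma zspan_add: "S \<subseteq> carrier G \<Longrightarrow> x \<in> zspan G S \<Longrightarrow> y \<in> zspan G S \<Longrightarrow> x \<oplus> y \<in> zspan G S"
  unfolding zspan_def by (auto simp flip: zcomb_add)

lemma zspan_zmult:
  "finite S \<Longrightarrow> S \<subseteq> carrier G \<Longrightarrow> x \<in> zspan G S \<Longrightarrow> [(k::int)] \<cdot> x \<in> zspan G S"
  unfolding zspan_def by (auto simp: zcomb_scale)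

lemma zspan_uminus: "S \<subseteq> carrier G \<Longrightarrow> x \<in> zspan G S \<Longrightarrow> \<ominus> x \<in> zspan G S"
  unfolding zspan_def by (auto simp flip: zcomb_uminus)

lemma zspan_base: "finite S \<Longrightarrow> S \<subseteq> carrier G \<Longrightarrow> s \<in> S \<Longrightarrow> s \<in> zspan G S"
  using zspanI[of "\<lambda>x. if x = s then 1 else 0" S] zcomb_single[of S s 1] zmult_one[of s] by auto

lemma zspan_empty: "zspan G {} = {\<zero>}"
  unfolding zspan_def zcomb_def by simp

lemma zspan_finsum:
  assumes "finite T" "S \<subseteq> carrier G" "\<And>x. x \<in> T \<Longrightarrow> f x \<in> zspan G S"
  shows "finsum G f T \<in> zspan G S"
  using assms(1,3)
proof (induction T)
  case empty
  then show ?case using assms(2) by (simp add: zspan_zero)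
next
  case (insert x T)
  have "f \<in> T \<rightarrow> carrier G" "f x \<in> carrier G"
    using insert zspan_closed[OF assms(2)] by auto
  then show ?case using insert assms(2) by (simp add: zspan_add)
qed

lemma zbasis_zmult_eq:
  assumes basis: "zbasis G ms" and "x \<in> set ms" "y \<in> set ms"
    and eq: "[(k::int)] \<cdot> x = [(l::int)] \<cdot> y" and "k \<noteq> 0"
  shows "x = y" and "k = l"
proof -
  have S: "finite (set ms)" "set ms \<subseteq> carrier G" using basis by (auto simp: zbasis_def)
  have "zcomb G (\<lambda>z. if z = x then k else 0) (set ms) = zcomb G (\<lambda>z. if z = y then l else 0) (set ms)"
    using assms S by (simp add: zcomb_single)
  from zbasis_unique[OF basis this \<open>x \<in> set ms\<close>] \<open>k \<noteq> 0\<close> show "x = y" "k = l"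
    by (auto split: if_splits)
qed

lemma zbasis_nonzero:
  assumes basis: "zbasis G ms" and "x \<in> set ms"
  shows "x \<noteq> \<zero>"
proof
  assume "x = \<zero>"
  moreover have "x \<in> carrier G" using assms by (auto simp: zbasis_def)
  ultimately have "[(1::int)] \<cdot> x = [(2::int)] \<cdot> x" by simp
  from zbasis_zmult_eq(2)[OF basis assms(2,2) this] show False by simp
qed

text \<open>
Independence makes the span of part of a basis meet the multiples of a basis element trivially
unless that element belongs to the part. This is how submodules of a cyclic module are propagated
along its cycle.
\<close>

lemma zbasis_span_subset:
  assumes basis: "zbasis G ms" and T: "T \<subseteq> set ms" and x: "x \<in> set ms"
    and mem: "[(k::int)] \<cdot> x \<in> zspan G T" and "k \<noteq> 0"
  shows "x \<in> T"
proof (rule ccontr)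
  assume "x \<notin> T"
  have S: "finite (set ms)" "set ms \<subseteq> carrier G" using basis by (auto simp: zbasis_def)
  obtain a where a: "[k] \<cdot> x = zcomb G a T" using mem unfolding zspan_def by blast
  have "zcomb G a T = zcomb G (\<lambda>z. if z \<in> T then a z else 0) (set ms)"
    unfolding zcomb_def using S T
    by (intro add.finprod_mono_neutral_cong_left) auto
  hence "zcomb G (\<lambda>z. if z = x then k else 0) (set ms) = zcomb G (\<lambda>z. if z \<in> T then a z else 0) (set ms)"
    using a S x by (simp add: zcomb_single)
  from zbasis_unique[OF basis this x] \<open>x \<notin> T\<close> \<open>k \<noteq> 0\<close> show False by simp
qed

lemma hom_ext_zbasis:
  assumes basis: "zbasis G ms" and H: "abelian_group H"
    and hom: "\<phi> \<in> hom (add_monoid G) (add_monoid H)" "\<psi> \<in> hom (add_monoid G) (add_monoid H)"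
    and eq: "\<And>m. m \<in> set ms \<Longrightarrow> \<phi> m = \<psi> m" and x: "x \<in> carrier G"
  shows "\<phi> x = \<psi> x"
proof -
  interpret H: abelian_group H by fact
  have S: "finite (set ms)" "set ms \<subseteq> carrier G" using basis by (auto simp: zbasis_def)
  obtain a where a: "x = zcomb G a (set ms)" using zbasis_expand[OF basis x] by blast
  have cl: "\<psi> z \<in> carrier H" if "z \<in> carrier G" for z using hom(2) that by (auto simp: hom_def)
  show ?thesis
    unfolding a zcomb_hom[OF H hom(1) S] zcomb_hom[OF H hom(2) S]
    using S by (intro H.finsum_cong') (auto simp: eq cl subset_iff)
qed

text \<open>
Freeness as a universal property: a choice of images for a basis extends to a homomorphism.
\<close>

lemma zbasis_hom_extension:
  assumes basis: "zbasis G ms" and H: "abelian_group H" and \<tau>: "\<tau> \<in> set ms \<rightarrow> carrier H"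
  obtains \<psi> where "\<psi> \<in> hom (add_monoid G) (add_monoid H)" "\<And>m. m \<in> set ms \<Longrightarrow> \<psi> m = \<tau> m"
proof -
  interpret H: abelian_group H by fact
  have S: "finite (set ms)" "set ms \<subseteq> carrier G" using basis by (auto simp: zbasis_def)
  define crd where "crd x = (SOME a. x = zcomb G a (set ms))" for x
  have crd: "zcomb G (crd x) (set ms) = x" if "x \<in> carrier G" for x
    using zbasis_expand[OF basis that] unfolding crd_def by (metis (mono_tags, lifting) someI)
  define \<psi> where "\<psi> x = (\<Oplus>\<^bsub>H\<^esub>s\<in>set ms. [crd x s] \<cdot>\<^bsub>H\<^esub> \<tau> s)" for x
  have cl: "\<tau> s \<in> carrier H" if "s \<in> set ms" for s using \<tau> that by auto
  show ?thesis
  proof (rule that[of \<psi>])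
    show "\<psi> \<in> hom (add_monoid G) (add_monoid H)"
    proof (rule homI)
      fix x assume "x \<in> carrier (add_monoid G)"
      thus "\<psi> x \<in> carrier (add_monoid H)" by (simp add: \<psi>_def H.finsum_closed cl Pi_def)
    next
      fix x y assume "x \<in> carrier (add_monoid G)" "y \<in> carrier (add_monoid G)"
      hence xy: "x \<in> carrier G" "y \<in> carrier G" by auto
      have "zcomb G (crd (x \<oplus> y)) (set ms) = zcomb G (\<lambda>s. crd x s + crd y s) (set ms)"
        using xy S by (simp add: crd zcomb_add)
      from zbasis_unique[OF basis this]
      have eq: "crd (x \<oplus> y) s = crd x s + crd y s" if "s \<in> set ms" for s
        using that by simp
      have "\<psi> (x \<oplus> y) = (\<Oplus>\<^bsub>H\<^esub>s\<in>set ms. [crd x s] \<cdot>\<^bsub>H\<^esub> \<tau> s \<oplus>\<^bsub>H\<^esub> [crd y s] \<cdot>\<^bsub>H\<^esub> \<tau> s)"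
        unfolding \<psi>_def by (intro H.finsum_cong') (auto simp: eq cl H.zmult_add)
      also have "\<dots> = \<psi> x \<oplus>\<^bsub>H\<^esub> \<psi> y"
        unfolding \<psi>_def by (intro H.finsum_addf) (auto simp: cl)
      finally show "\<psi> (x \<otimes>\<^bsub>add_monoid G\<^esub> y) = \<psi> x \<otimes>\<^bsub>add_monoid H\<^esub> \<psi> y" by simp
    qed
  next
    fix m assume m: "m \<in> set ms"
    hence "zcomb G (crd m) (set ms) = zcomb G (\<lambda>z. if z = m then 1 else 0) (set ms)"
      using S zcomb_single[OF S m, of 1] by (auto simp: crd zmult_one)
    from zbasis_unique[OF basis this]
    have eq: "crd m s = (if s = m then 1 else 0)" if "s \<in> set ms" for s
      using that by simp
    have "\<psi> m = (\<Oplus>\<^bsub>H\<^esub>s\<in>set ms. if m = s then \<tau> s else \<zero>\<^bsub>H\<^esub>)"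
      unfolding \<psi>_def by (intro H.finsum_cong') (auto simp: eq cl H.zmult_one)
    also have "\<dots> = \<tau> m"
      using m by (intro H.add.finprod_singleton) (auto simp: cl)
    finally show "\<psi> m = \<tau> m" .
  qed
qed

end

context module
begin

lemma smult_hom: "r \<in> carrier R \<Longrightarrow> (\<lambda>x. r \<odot>\<^bsub>M\<^esub> x) \<in> hom (add_monoid M) (add_monoid M)"
  by (auto simp: hom_def smult_r_distr)

lemma smult_zcomb:
  assumes "r \<in> carrier R" "finite S" "S \<subseteq> carrier M"
  shows "r \<odot>\<^bsub>M\<^esub> zcomb M a S = (\<Oplus>\<^bsub>M\<^esub>x\<in>S. [a x] \<cdot>\<^bsub>M\<^esub> (r \<odot>\<^bsub>M\<^esub> x))"
  by (intro M.zcomb_hom smult_hom assms M.abelian_group_axioms)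

lemma smult_add_pow:
  assumes "r \<in> carrier R" "x \<in> carrier M"
  shows "r \<odot>\<^bsub>M\<^esub> ([(k::int)] \<cdot>\<^bsub>M\<^esub> x) = [k] \<cdot>\<^bsub>M\<^esub> (r \<odot>\<^bsub>M\<^esub> x)"
proof -
  interpret h: group_hom "add_monoid M" "add_monoid M" "\<lambda>x. r \<odot>\<^bsub>M\<^esub> x"
    using smult_hom[OF assms(1)] by unfold_locales (auto simp: hom_def)
  show ?thesis using h.hom_int_pow[of x k] assms(2) by (simp add: add_pow_def)
qed

lemma add_pow_smult:
  assumes "x \<in> carrier M" "r \<in> carrier R"
  shows "([(k::int)] \<cdot> r) \<odot>\<^bsub>M\<^esub> x = [k] \<cdot>\<^bsub>M\<^esub> (r \<odot>\<^bsub>M\<^esub> x)"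
proof -
  interpret h: group_hom "add_monoid R" "add_monoid M" "\<lambda>r. r \<odot>\<^bsub>M\<^esub> x"
    using assms(1) by unfold_locales (auto simp: hom_def smult_l_distr)
  show ?thesis using h.hom_int_pow[of r k] assms(2) by (simp add: add_pow_def)
qed

text \<open>
If \<open>A\<close> and \<open>B\<close> are the matrices of \<open>r\<close> and \<open>s\<close>, then \<open>A * B = B * A\<close> is \<open>d\<close> times the identity.
All entries are nonnegative, so an off-diagonal zero of a product makes every summand zero: whenever
\<open>A m n > 0\<close>, row \<open>n\<close> of \<open>B\<close> is supported at \<open>m\<close>, and vice versa. As no row vanishes, each row of
\<open>A\<close> has exactly one positive entry, and different rows have it in different columns.
\<close>

lemma smult_monomial:
  fixes d :: nat
  assumes basis: "zbasis M ms"
    and r: "r \<in> carrier R" and s: "s \<in> carrier R"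
    and rs: "r \<otimes> s = [int d] \<cdot> \<one>" and d: "d > 0"
    and rpos: "\<And>m. m \<in> set ms \<Longrightarrow> \<exists>a :: 'c \<Rightarrow> nat. r \<odot>\<^bsub>M\<^esub> m = zcomb M (\<lambda>z. int (a z)) (set ms)"
    and spos: "\<And>m. m \<in> set ms \<Longrightarrow> \<exists>a :: 'c \<Rightarrow> nat. s \<odot>\<^bsub>M\<^esub> m = zcomb M (\<lambda>z. int (a z)) (set ms)"
  obtains \<pi> and a :: "'c \<Rightarrow> nat"
    where "\<And>m. m \<in> set ms \<Longrightarrow> r \<odot>\<^bsub>M\<^esub> m = [int (a m)] \<cdot>\<^bsub>M\<^esub> \<pi> m"
      and "\<And>m. m \<in> set ms \<Longrightarrow> \<pi> m \<in> set ms" and "inj_on \<pi> (set ms)"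
proof -
  define S where "S = set ms"
  have fin: "finite S" and S: "S \<subseteq> carrier M" using basis by (auto simp: S_def zbasis_def)
  obtain A :: "'c \<Rightarrow> 'c \<Rightarrow> nat" where
    A: "\<And>m. m \<in> S \<Longrightarrow> r \<odot>\<^bsub>M\<^esub> m = zcomb M (\<lambda>z. int (A m z)) S"
    using rpos unfolding S_def by metis
  obtain B :: "'c \<Rightarrow> 'c \<Rightarrow> nat" where
    B: "\<And>m. m \<in> S \<Longrightarrow> s \<odot>\<^bsub>M\<^esub> m = zcomb M (\<lambda>z. int (B m z)) S"
    using spos unfolding S_def by metis
  \<comment> \<open>Both products of the two matrices are needed, so the computation is done for an arbitrary
    ordered pair of ring elements.\<close>
  have key: "(\<Sum>y\<in>S. Q m y * P y l) = (if l = m then d else 0)"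
    if "m \<in> S" "l \<in> S" and t: "t \<in> carrier R" and u: "u \<in> carrier R"
      and tu: "t \<otimes> u = [int d] \<cdot> \<one>"
      and P: "\<And>m. m \<in> S \<Longrightarrow> t \<odot>\<^bsub>M\<^esub> m = zcomb M (\<lambda>z. int (P m z)) S"
      and Q: "\<And>m. m \<in> S \<Longrightarrow> u \<odot>\<^bsub>M\<^esub> m = zcomb M (\<lambda>z. int (Q m z)) S"
    for t u m l and P Q :: "'c \<Rightarrow> 'c \<Rightarrow> nat"
  proof -
    have m: "m \<in> carrier M" using that S by auto
    have "zcomb M (\<lambda>x. if x = m then int d else 0) S = [int d] \<cdot>\<^bsub>M\<^esub> m"
      using fin S that by (simp add: M.zcomb_single)
    also have "\<dots> = (t \<otimes> u) \<odot>\<^bsub>M\<^esub> m" using m by (simp add: tu add_pow_smult)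
    also have "\<dots> = t \<odot>\<^bsub>M\<^esub> zcomb M (\<lambda>z. int (Q m z)) S"
      using smult_assoc1[OF t u m] Q[OF \<open>m \<in> S\<close>] by simp
    also have "\<dots> = (\<Oplus>\<^bsub>M\<^esub>x\<in>S. [int (Q m x)] \<cdot>\<^bsub>M\<^esub> zcomb M (\<lambda>z. int (P x z)) S)"
      using t fin S P by (subst smult_zcomb) (auto intro!: M.finsum_cong')
    also have "\<dots> = zcomb M (\<lambda>z. \<Sum>x\<in>S. int (Q m x) * int (P x z)) S"
      by (rule M.finsum_zcomb) (use fin S in auto)
    finally have "(if l = m then int d else 0) = (\<Sum>x\<in>S. int (Q m x) * int (P x l))"
      using M.zbasis_unique[OF basis, folded S_def] that by blast
    also have "\<dots> = int (\<Sum>x\<in>S. Q m x * P x l)" by simp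
    finally show ?thesis by (metis of_nat_0 of_nat_eq_iff)
  qed
  have sr: "s \<otimes> r = [int d] \<cdot> \<one>" using rs r s by (simp add: R.m_comm)
  have BA: "(\<Sum>y\<in>S. B m y * A y l) = (if l = m then d else 0)" if "m \<in> S" "l \<in> S" for m l
    using key[OF that r s rs] A B by simp
  have AB: "(\<Sum>y\<in>S. A m y * B y l) = (if l = m then d else 0)" if "m \<in> S" "l \<in> S" for m l
    using key[OF that s r sr] A B by simp
  have exA: "\<exists>n\<in>S. A m n > 0" if "m \<in> S" for m
  proof (rule ccontr)
    assume "\<not> ?thesis"
    hence "\<forall>n\<in>S. A m n = 0" by simp
    thus False using AB[OF that that] d by simp
  qed
  have exB: "\<exists>n\<in>S. B m n > 0" if "m \<in> S" for m
  proof (rule ccontr)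
    assume "\<not> ?thesis"
    hence "\<forall>n\<in>S. B m n = 0" by simp
    thus False using BA[OF that that] d by simp
  qed
  have ABz: "l = m" if "m \<in> S" "n \<in> S" "l \<in> S" "A m n > 0" "B n l > 0" for m n l
  proof (rule ccontr)
    assume "l \<noteq> m"
    hence "(\<Sum>y\<in>S. A m y * B y l) = 0" using AB that by simp
    hence "A m n * B n l = 0" using fin \<open>n \<in> S\<close> by (simp add: sum_eq_0_iff)
    thus False using that by simp
  qed
  have BAz: "l = m" if "m \<in> S" "n \<in> S" "l \<in> S" "B m n > 0" "A n l > 0" for m n l
  proof (rule ccontr)
    assume "l \<noteq> m"
    hence "(\<Sum>y\<in>S. B m y * A y l) = 0" using BA that by simp
    hence "B m n * A n l = 0" using fin \<open>n \<in> S\<close> by (simp add: sum_eq_0_iff)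
    thus False using that by simp
  qed
  have uniq: "n = n'" if "m \<in> S" "n \<in> S" "n' \<in> S" "A m n > 0" "A m n' > 0" for m n n'
  proof -
    obtain l where l: "l \<in> S" "B n l > 0" using exB[OF \<open>n \<in> S\<close>] by blast
    with ABz that have "l = m" by blast
    thus ?thesis using BAz[of n m n'] that l by simp
  qed
  define \<pi> where "\<pi> m = (SOME n. n \<in> S \<and> A m n > 0)" for m
  have \<pi>: "\<pi> m \<in> S" "A m (\<pi> m) > 0" if "m \<in> S" for m
    using someI_ex[of "\<lambda>n. n \<in> S \<and> A m n > 0"] exA[OF that] unfolding \<pi>_def by blast+
  show ?thesis
  proof (rule that[of "\<lambda>m. A m (\<pi> m)" \<pi>])
    fix m assume "m \<in> set ms"
    hence m: "m \<in> S" by (simp add: S_def)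
    have "r \<odot>\<^bsub>M\<^esub> m = zcomb M (\<lambda>z. int (A m z)) S" by (rule A[OF m])
    also have "\<dots> = zcomb M (\<lambda>z. if z = \<pi> m then int (A m (\<pi> m)) else 0) S"
      using uniq[OF m] \<pi>[OF m] by (intro M.zcomb_cong S) (metis gr0I of_nat_0)
    also have "\<dots> = [int (A m (\<pi> m))] \<cdot>\<^bsub>M\<^esub> \<pi> m"
      by (rule M.zcomb_single) (use fin S \<pi> m in auto)
    finally show "r \<odot>\<^bsub>M\<^esub> m = [int (A m (\<pi> m))] \<cdot>\<^bsub>M\<^esub> \<pi> m" .
    show "\<pi> m \<in> set ms" using \<pi>[OF m] by (simp add: S_def)
  next
    show "inj_on \<pi> (set ms)"
    proof (rule inj_onI)
      fix m m' assume "m \<in> set ms" "m' \<in> set ms" and eq: "\<pi> m = \<pi> m'"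
      hence m: "m \<in> S" "m' \<in> S" by (auto simp: S_def)
      obtain l where "l \<in> S" "B (\<pi> m) l > 0" using exB[OF \<pi>(1)[OF m(1)]] by blast
      thus "m = m'" using ABz \<pi> m eq by metis
    qed
  qed
qed

end

section \<open>Integer combinations of real numbers\<close>

lemma real_add_pow_int:
  fixes G :: "(real, 'm) ring_scheme"
  assumes "abelian_group G" and add: "add G = (+)" and zero: "zero G = 0" and x: "x \<in> carrier G"
  shows "[(k::int)] \<cdot>\<^bsub>G\<^esub> x = of_int k * x"
proof -
  interpret abelian_group G by fact
  have nat: "[(n::nat)] \<cdot>\<^bsub>G\<^esub> x = of_nat n * x" for n
    by (induction n) (simp_all add: add_pow_def nat_pow_def add zero algebra_simps)
  have neg: "\<ominus>\<^bsub>G\<^esub> y = - y" if "y \<in> carrier G" for y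
    using r_neg[OF that] by (simp add: add zero)
  have cl: "[(n::nat)] \<cdot>\<^bsub>G\<^esub> x \<in> carrier G" for n
    using x by (simp add: add.nat_pow_closed)
  show ?thesis
  proof (cases "k \<ge> 0")
    case True
    thus ?thesis by (simp add: add_pow_int_ge nat)
  next
    case False
    thus ?thesis using neg[OF cl[of "nat (-k)"]] by (simp add: add_pow_int_lt nat)
  qed
qed

lemma real_finsum:
  fixes G :: "(real, 'm) ring_scheme"
  assumes "abelian_group G" and add: "add G = (+)" and zero: "zero G = 0"
    and "finite S" "f \<in> S \<rightarrow> carrier G"
  shows "finsum G f S = sum f S"
proof -
  interpret abelian_group G by fact
  show ?thesis using assms(4,5) by (induction S) (auto simp: zero add)
qed

lemma real_zcomb:
  fixes G :: "(real, 'm) ring_scheme"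
  assumes G: "abelian_group G" and add: "add G = (+)" and zero: "zero G = 0"
    and S: "finite S" "S \<subseteq> carrier G"
  shows "zcomb G a S = (\<Sum>x\<in>S. of_int (a x) * x)"
proof -
  interpret abelian_group G by fact
  have "zcomb G a S = (\<Sum>x\<in>S. [a x] \<cdot>\<^bsub>G\<^esub> x)"
    unfolding zcomb_def using S by (intro real_finsum G add zero) auto
  also have "\<dots> = (\<Sum>x\<in>S. of_int (a x) * x)"
    using S by (intro sum.cong) (auto simp: real_add_pow_int[OF G add zero])
  finally show ?thesis .
qed

text \<open>
The coefficients of a combination are indexed by the real numbers \<open>u k\<close> themselves, so independence
first has to show that \<open>u\<close> lists them without repetition.
\<close>

lemma real_zbasis:
  fixes G :: "(real, 'm) ring_scheme" and u :: "nat \<Rightarrow> real"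
  assumes G: "abelian_group G" and add: "add G = (+)" and zero: "zero G = 0"
    and carr: "carrier G = {\<Sum>k<n. of_int (a k) * u k |a :: nat \<Rightarrow> int. True}"
    and indep: "\<And>a :: nat \<Rightarrow> int. (\<Sum>k<n. of_int (a k) * u k) = 0 \<Longrightarrow> \<forall>k<n. a k = 0"
  shows "inj_on u {..<n}" and "zbasis G (map u [0..<n])"
proof -
  show inj: "inj_on u {..<n}"
  proof (rule inj_onI, rule ccontr)
    fix i j assume ij: "i \<in> {..<n}" "j \<in> {..<n}" "u i = u j" "i \<noteq> j"
    define a :: "nat \<Rightarrow> int" where "a k = (if k = i then 1 else 0) - (if k = j then 1 else 0)" for k
    have "(\<Sum>k<n. of_int (a k) * u k) = u i - u j"
      using ij(1,2) by (simp add: a_def left_diff_distrib sum_subtractf if_distrib[of "\<lambda>x. x * _"] if_distrib[of real_of_int] cong: if_cong)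
    hence "a i = 0" using indep ij by simp
    thus False using ij by (simp add: a_def)
  qed
  have set: "set (map u [0..<n]) = u ` {..<n}" by (auto simp: atLeast0LessThan)
  have mem: "u i \<in> carrier G" if "i < n" for i
  proof -
    have "u i = (\<Sum>k<n. of_int (if k = i then 1 else 0) * u k)"
      using that by (simp add: if_distrib[of "\<lambda>x. x * _"] if_distrib[of of_int] cong: if_cong)
    thus ?thesis unfolding carr by (intro CollectI exI conjI TrueI)
  qed
  have sub: "u ` {..<n} \<subseteq> carrier G" using mem by auto
  have comb: "zcomb G a (u ` {..<n}) = (\<Sum>k<n. of_int (a (u k)) * u k)" for a
    using real_zcomb[OF G add zero _ sub] inj by (simp add: sum.reindex)
  have span: "zspan G (u ` {..<n}) = carrier G"
  proof
    show "zspan G (u ` {..<n}) \<subseteq> carrier G"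
      unfolding zspan_def comb carr by auto
  next
    show "carrier G \<subseteq> zspan G (u ` {..<n})"
    proof
      fix x assume "x \<in> carrier G"
      then obtain a :: "nat \<Rightarrow> int" where x: "x = (\<Sum>k<n. of_int (a k) * u k)" unfolding carr by blast
      have "x = zcomb G (\<lambda>y. a (inv_into {..<n} u y)) (u ` {..<n})"
        unfolding comb x using inj by (intro sum.cong) auto
      thus "x \<in> zspan G (u ` {..<n})" unfolding zspan_def by blast
    qed
  qed
  have dist: "distinct (map u [0..<n])" using inj by (simp add: distinct_map atLeast0LessThan)
  have "\<forall>b\<in>u ` {..<n}. a b = 0" if "zcomb G a (u ` {..<n}) = \<zero>\<^bsub>G\<^esub>" for a
    using indep[of "\<lambda>k. a (u k)"] that unfolding comb zero by auto
  thus "zbasis G (map u [0..<n])"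
    unfolding zbasis_def set using dist sub span by blast
qed

section \<open>The ring generated by a root of a square-free number\<close>

locale squarefree_root =
  fixes d N :: nat
  assumes N2: "N \<ge> 2" and d2: "d \<ge> 2" and sqf: "squarefree d"
begin

abbreviation \<alpha> :: real where "\<alpha> \<equiv> root N (real d)"
abbreviation R :: "real ring" where "R \<equiv> root_ring d N"
abbreviation xs :: "real list" where "xs \<equiv> root_basis d N"

lemma N0: "N > 0" using N2 by simp

lemma \<alpha>_pow_N: "\<alpha> ^ N = real d" using N0 by simp

lemma \<alpha>_pos: "\<alpha> > 0" using N0 d2 by simp

lemma independent:
  fixes a :: "nat \<Rightarrow> int"
  assumes "(\<Sum>k<N. of_int (a k) * \<alpha> ^ k) = 0"
  shows "\<forall>k<N. a k = 0"
proof -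
  obtain q where q: "prime q" "q dvd d" using prime_factor_nat[of d] d2 by auto
  have "multiplicity q d = 1"
    using q sqf d2 squarefree_factorial_semiring'[of d] by (auto simp: prime_factors_dvd)
  thus ?thesis using root_powers_independent[OF q(1) _ _ N0 assms] d2 by auto
qed

lemma R_simps [simp]:
  "add R = (+)" "monoid.mult R = (*)" "zero R = 0" "one R = 1"
  unfolding root_ring_def by (simp_all only: ring.select_convs monoid.select_convs)

lemma carrier_R: "carrier R = {\<Sum>i\<le>n. of_int (a i) * \<alpha> ^ i |(n::nat) a. True}"
  unfolding root_ring_def by (simp only: partial_object.select_convs)

lemma R_memI: "(\<Sum>i\<le>n. of_int (a i) * \<alpha> ^ i) \<in> carrier R"
  unfolding carrier_R by (rule CollectI, rule exI[of _ n], rule exI[of _ a]) simp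

lemma horner_closed: "r \<in> carrier R \<Longrightarrow> of_int b + \<alpha> * r \<in> carrier R"
proof -
  assume "r \<in> carrier R"
  then obtain n and a :: "nat \<Rightarrow> int" where r: "r = (\<Sum>i\<le>n. of_int (a i) * \<alpha> ^ i)" unfolding carrier_R by blast
  have "of_int b + \<alpha> * r = (\<Sum>i\<le>Suc n. of_int (case i of 0 \<Rightarrow> b | Suc j \<Rightarrow> a j) * \<alpha> ^ i)"
    unfolding sum.atMost_Suc_shift r by (simp add: sum_distrib_left mult_ac)
  thus ?thesis using R_memI[of "case_nat b a" "Suc n"] by simp
qed

lemma of_int_in_R [simp]: "of_int b \<in> carrier R"
  using R_memI[of "\<lambda>_. b" 0] by simp

lemma zero_in_R [simp]: "0 \<in> carrier R" and one_in_R [simp]: "1 \<in> carrier R"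
  using of_int_in_R[of 0] of_int_in_R[of 1] by auto

lemma \<alpha>_in_R [simp]: "\<alpha> \<in> carrier R"
  using horner_closed[of 1 0] by simp

text \<open>
Horner's scheme: the ring is generated from \<open>0\<close> by multiplying with \<open>\<alpha>\<close> and adding integers.
Hence any property of the action of the ring needs to be checked only for integers and for \<open>\<alpha>\<close>.
\<close>

lemma R_induct [consumes 1, case_names zero horner]:
  assumes "r \<in> carrier R" and "P 0"
    and step: "\<And>b r. r \<in> carrier R \<Longrightarrow> P r \<Longrightarrow> P (of_int b + \<alpha> * r)"
  shows "P r"
proof -
  have "P (\<Sum>i\<le>n. of_int (a i) * \<alpha> ^ i)" for n and a :: "nat \<Rightarrow> int"
  proof (induction n arbitrary: a)
    case 0
    show ?case using step[of 0 "a 0"] \<open>P 0\<close> by simp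
  next
    case (Suc n)
    have "(\<Sum>i\<le>Suc n. of_int (a i) * \<alpha> ^ i) = of_int (a 0) + \<alpha> * (\<Sum>i\<le>n. of_int (a (Suc i)) * \<alpha> ^ i)"
      unfolding sum.atMost_Suc_shift by (simp add: sum_distrib_left mult_ac)
    moreover have "(\<Sum>i\<le>n. of_int (a (Suc i)) * \<alpha> ^ i) \<in> carrier R"
      by (rule R_memI)
    ultimately show ?case using step Suc.IH[of "\<lambda>i. a (Suc i)"] by simp
  qed
  thus ?thesis using assms(1) unfolding carrier_R by blast
qed

lemma R_add_closed: "r \<in> carrier R \<Longrightarrow> s \<in> carrier R \<Longrightarrow> r + s \<in> carrier R"
proof (induction r arbitrary: s rule: R_induct)
  case zero
  then show ?case by simp
next
  case (horner b r)
  have "\<exists>b' s'. s' \<in> carrier R \<and> s = of_int b' + \<alpha> * s'"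
    using horner.prems
  proof (induction s rule: R_induct)
    case zero
    show ?case by (rule exI[of _ 0], rule exI[of _ 0]) simp
  qed blast
  then obtain b' s' where s': "s' \<in> carrier R" "s = of_int b' + \<alpha> * s'" by blast
  have "of_int b + \<alpha> * r + s = of_int (b + b') + \<alpha> * (r + s')"
    by (simp add: s' algebra_simps)
  moreover have "\<dots> \<in> carrier R" by (intro horner_closed horner.IH s')
  ultimately show ?case by (simp only:)
qed

lemma R_scale_closed: "r \<in> carrier R \<Longrightarrow> of_int k * r \<in> carrier R"
proof (induction r rule: R_induct)
  case (horner b r)
  have "of_int k * (of_int b + \<alpha> * r) = of_int (k * b) + \<alpha> * (of_int k * r)"
    by (simp add: algebra_simps)
  thus ?case using horner_closed[OF horner.IH, of "k * b"] by simp
qed simp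

lemma R_mult_closed: "r \<in> carrier R \<Longrightarrow> s \<in> carrier R \<Longrightarrow> r * s \<in> carrier R"
proof (induction r rule: R_induct)
  case (horner b r)
  have "(of_int b + \<alpha> * r) * s = of_int b * s + (of_int 0 + \<alpha> * (r * s))"
    by (simp add: algebra_simps)
  thus ?case using R_add_closed R_scale_closed horner_closed horner by presburger
qed simp

lemma R_uminus_closed: "r \<in> carrier R \<Longrightarrow> - r \<in> carrier R"
  using R_scale_closed[of r "-1"] by simp

lemma R_domain: "domain R"
proof (intro domain.intro domain_axioms.intro)
  show "cring R"
  proof (rule cringI)
    show "abelian_group R"
      by (rule abelian_groupI) (auto simp: R_add_closed intro!: bexI[of _ "- _"] R_uminus_closed)
    show "Group.comm_monoid R"
      by (rule comm_monoidI) (auto simp: R_mult_closed)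
  qed (auto simp: algebra_simps)
qed auto

lemma R_cring: "cring R" using R_domain by (simp add: domain_def)

lemma R_abelian: "abelian_group R" using R_cring by (simp add: cring_def ring_def)

lemma carrier_R_span: "carrier R = {\<Sum>k<N. of_int (a k) * \<alpha> ^ k |a :: nat \<Rightarrow> int. True}" (is "_ = ?S")
proof
  show "?S \<subseteq> carrier R"
  proof safe
    fix a :: "nat \<Rightarrow> int"
    have "{..<N} = {..N - 1}" using N0 by auto
    thus "(\<Sum>k<N. of_int (a k) * \<alpha> ^ k) \<in> carrier R"
      using R_memI[of a "N - 1"] by simp
  qed
next
  show "carrier R \<subseteq> ?S"
  proof
    fix r assume "r \<in> carrier R"
    thus "r \<in> ?S"
    proof (induction r rule: R_induct)
      case zero
      show ?case by (intro CollectI exI[of _ "\<lambda>_. 0"]) simp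
    next
      case (horner b r)
      then obtain a :: "nat \<Rightarrow> int" where r: "r = (\<Sum>k<N. of_int (a k) * \<alpha> ^ k)" by blast
      obtain n where n: "N = Suc n" using N0 gr0_implies_Suc by blast
      have lt: "{..<N} = {..<Suc n}" by (simp add: n)
      \<comment> \<open>Multiplication by \<open>\<alpha>\<close> shifts the coefficients; the top one wraps
        around to the constant term with a factor \<open>d\<close>.\<close>
      have aN: "\<alpha> * \<alpha> ^ n = real d" using \<alpha>_pow_N n by (metis power_Suc)
      define a' where "a' k = (case k of 0 \<Rightarrow> b + a n * int d | Suc j \<Rightarrow> a j)" for k
      have "of_int b + \<alpha> * r = of_int b + (\<Sum>k<n. of_int (a k) * \<alpha> ^ Suc k) + of_int (a n) * (\<alpha> * \<alpha> ^ n)"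
        unfolding r lt by (simp add: sum_distrib_left algebra_simps)
      also have "\<dots> = (\<Sum>k<N. of_int (a' k) * \<alpha> ^ k)"
        unfolding aN lt sum.lessThan_Suc_shift a'_def by simp
      finally show ?case by (intro CollectI exI conjI TrueI)
    qed
  qed
qed

lemma xs_eq: "xs = map (\<lambda>k. \<alpha> ^ k) [0..<N]" by (rule root_basis_def)

lemma set_xs: "set xs = (\<lambda>k. \<alpha> ^ k) ` {..<N}" by (auto simp: xs_eq atLeast0LessThan)

lemma R_zbasis: "zbasis R xs"
  unfolding xs_eq by (rule real_zbasis(2)[OF R_abelian _ _ carrier_R_span independent]) auto

lemma R_add_pow: "r \<in> carrier R \<Longrightarrow> [(k::int)] \<cdot>\<^bsub>R\<^esub> r = of_int k * r"
  by (rule real_add_pow_int[OF R_abelian]) auto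

lemma R_zplus: "zplus_ring R xs"
proof -
  have "\<exists>c :: real \<Rightarrow> nat. x \<otimes>\<^bsub>R\<^esub> y = zcomb R (\<lambda>z. int (c z)) (set xs)"
    if xy: "x \<in> set xs" "y \<in> set xs" for x y
  proof -
    obtain i j where ij: "x = \<alpha> ^ i" "y = \<alpha> ^ j" using xy unfolding set_xs by auto
    define q where "q = (i + j) div N"
    define s where "s = \<alpha> ^ ((i + j) mod N)"
    have s: "s \<in> set xs" using N0 by (auto simp: set_xs s_def)
    have sub: "set xs \<subseteq> carrier R" using R_zbasis by (simp add: zbasis_def)
    have "zcomb R (\<lambda>z. if z = s then int (d ^ q) else 0) (set xs) = [int (d ^ q)] \<cdot>\<^bsub>R\<^esub> s"
      by (rule abelian_group.zcomb_single[OF R_abelian]) (use s sub in auto)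
    also have "\<dots> = (\<alpha> ^ N) ^ q * s"
      using R_add_pow[of s "int (d ^ q)"] s sub unfolding \<alpha>_pow_N by auto
    also have "\<dots> = x \<otimes>\<^bsub>R\<^esub> y"
      by (simp add: ij s_def q_def flip: power_mult power_add)
    finally show ?thesis
      by (intro exI[of _ "\<lambda>z. if z = s then d ^ q else 0"]) (simp add: if_distrib cong: if_cong)
  qed
  moreover have "xs \<noteq> []" "hd xs = 1" using N0 by (auto simp: xs_eq upt_conv_Cons)
  ultimately show ?thesis unfolding zplus_ring_def using R_domain R_zbasis by auto
qed

section \<open>Cyclic presentations\<close>

text \<open>
The enumeration \<open>e\<close> arranges the basis in a cycle along which \<open>\<alpha>\<close> moves, and \<open>c\<close> records the
multipliers. The enumeration is kept apart from the order of the list \<open>ms\<close>, so that the permutation in the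
notion of isomorphism and the choice of a starting point on the cycle can be treated alike.
\<close>

definition cyclic_presentation ::
  "(real, 'b) module \<Rightarrow> 'b list \<Rightarrow> (nat \<Rightarrow> 'b) \<Rightarrow> (nat \<Rightarrow> nat) \<Rightarrow> bool" where
  "cyclic_presentation M ms e c \<longleftrightarrow>
     zplus_module R xs M ms \<and> bij_betw e {..<N} (set ms) \<and>
     (\<forall>k<N. \<alpha> \<odot>\<^bsub>M\<^esub> e k = [int (c k)] \<cdot>\<^bsub>M\<^esub> e (Suc k mod N)) \<and> (\<Prod>k<N. c k) = d"

lemma R_one_zmult: "[(b::int)] \<cdot>\<^bsub>R\<^esub> \<one>\<^bsub>R\<^esub> = of_int b"
  using R_add_pow[of 1 b] by simp

lemma smult_of_int:
  assumes "module R M" "x \<in> carrier M"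
  shows "of_int b \<odot>\<^bsub>M\<^esub> x = [b] \<cdot>\<^bsub>M\<^esub> x"
proof -
  interpret module R M by fact
  show ?thesis
    using add_pow_smult[of x "\<one>\<^bsub>R\<^esub>" b] assms(2) R_one_zmult[of b] smult_one[of x]
    by (simp del: R_simps)
qed

lemma smult_horner:
  assumes "module R M" "x \<in> carrier M" "r \<in> carrier R"
  shows "(of_int b + \<alpha> * r) \<odot>\<^bsub>M\<^esub> x = [b] \<cdot>\<^bsub>M\<^esub> x \<oplus>\<^bsub>M\<^esub> \<alpha> \<odot>\<^bsub>M\<^esub> (r \<odot>\<^bsub>M\<^esub> x)"
proof -
  interpret module R M by fact
  have "\<alpha> * r \<in> carrier R" using assms by (simp add: R_mult_closed)
  thus ?thesis
    using smult_l_distr[of "of_int b" "\<alpha> * r" x] smult_assoc1[of \<alpha> r x] assms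
      smult_of_int[OF assms(1,2), of b] by simp
qed

text \<open>
Multiples of basis elements by natural numbers are stable under \<open>\<alpha>\<close>, so every power of \<open>\<alpha>\<close> acts
with nonnegative coefficients.
\<close>

lemma zplus_moduleI:
  fixes M :: "(real, 'b) module"
  assumes "module R M" and basis: "zbasis M ms" and "ms \<noteq> []"
    and step: "\<And>m. m \<in> set ms \<Longrightarrow> \<exists>n\<in>set ms. \<exists>a :: nat. \<alpha> \<odot>\<^bsub>M\<^esub> m = [int a] \<cdot>\<^bsub>M\<^esub> n"
  shows "zplus_module R xs M ms"
proof -
  interpret module R M by fact
  have S: "finite (set ms)" "set ms \<subseteq> carrier M" using basis by (auto simp: zbasis_def)
  have pow: "\<exists>n\<in>set ms. \<exists>a :: nat. (\<alpha> ^ i) \<odot>\<^bsub>M\<^esub> m = [int a] \<cdot>\<^bsub>M\<^esub> n"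
    if m: "m \<in> set ms" for i m
  proof (induction i)
    case 0
    have "m \<in> carrier M" using m S by auto
    hence "(\<alpha> ^ 0) \<odot>\<^bsub>M\<^esub> m = [int 1] \<cdot>\<^bsub>M\<^esub> m"
      using smult_one[of m] by (simp add: M.zmult_one)
    thus ?case using m by blast
  next
    case (Suc i)
    then obtain n and a :: nat where n: "n \<in> set ms" "(\<alpha> ^ i) \<odot>\<^bsub>M\<^esub> m = [int a] \<cdot>\<^bsub>M\<^esub> n" by blast
    obtain n' and a' :: nat where n': "n' \<in> set ms" "\<alpha> \<odot>\<^bsub>M\<^esub> n = [int a'] \<cdot>\<^bsub>M\<^esub> n'" using step[OF n(1)] by blast
    have c: "m \<in> carrier M" "n \<in> carrier M" "n' \<in> carrier M" using m n n' S by auto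
    have "\<alpha> ^ i \<in> carrier R" by (induction i) (auto simp: R_mult_closed)
    hence "(\<alpha> ^ Suc i) \<odot>\<^bsub>M\<^esub> m = \<alpha> \<odot>\<^bsub>M\<^esub> ((\<alpha> ^ i) \<odot>\<^bsub>M\<^esub> m)"
      using smult_assoc1[of \<alpha> "\<alpha> ^ i" m] c by simp
    also have "\<dots> = [int (a * a')] \<cdot>\<^bsub>M\<^esub> n'"
      using c by (simp add: n n' smult_add_pow M.zmult_zmult)
    finally show ?case using n' by blast
  qed
  have "\<exists>a :: 'b \<Rightarrow> nat. x \<odot>\<^bsub>M\<^esub> m = zcomb M (\<lambda>z. int (a z)) (set ms)"
    if xm: "x \<in> set xs" "m \<in> set ms" for x m
  proof -
    obtain i where "x = \<alpha> ^ i" using xm unfolding set_xs by blast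
    then obtain n and a :: nat where n: "n \<in> set ms" "x \<odot>\<^bsub>M\<^esub> m = [int a] \<cdot>\<^bsub>M\<^esub> n"
      using pow[OF xm(2), of i] by blast
    have "x \<odot>\<^bsub>M\<^esub> m = zcomb M (\<lambda>z. int (if z = n then a else 0)) (set ms)"
      using M.zcomb_single[OF S n(1), of "int a"] n(2) by (simp add: if_distrib cong: if_cong)
    thus ?thesis by (rule exI[of _ "\<lambda>z. if z = n then a else 0"])
  qed
  thus ?thesis unfolding zplus_module_def using R_zplus assms by blast
qed

lemma presentation_facts:
  assumes "cyclic_presentation M ms e c"
  shows "module R M" "zbasis M ms" "finite (set ms)" "set ms \<subseteq> carrier M"
    "\<And>k. k < N \<Longrightarrow> e k \<in> set ms" "\<And>k. k < N \<Longrightarrow> e k \<in> carrier M" "e ` {..<N} = set ms" "inj_on e {..<N}"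
    "\<And>k. k < N \<Longrightarrow> \<alpha> \<odot>\<^bsub>M\<^esub> e k = [int (c k)] \<cdot>\<^bsub>M\<^esub> e (Suc k mod N)"
    "\<And>k. k < N \<Longrightarrow> c k > 0"
proof -
  show *: "module R M" "zbasis M ms" "finite (set ms)" "e ` {..<N} = set ms" "inj_on e {..<N}"
    "\<And>k. k < N \<Longrightarrow> \<alpha> \<odot>\<^bsub>M\<^esub> e k = [int (c k)] \<cdot>\<^bsub>M\<^esub> e (Suc k mod N)"
    using assms by (auto simp: cyclic_presentation_def zplus_module_def bij_betw_def)
  thus **: "set ms \<subseteq> carrier M" by (simp add: zbasis_def)
  show "e k \<in> set ms" if "k < N" for k using * that by auto
  thus "e k \<in> carrier M" if "k < N" for k using ** that by auto
  show "c k > 0" if "k < N" for k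
  proof (rule ccontr)
    assume "\<not> c k > 0"
    hence "(\<Prod>k<N. c k) = 0" using that by auto
    moreover have "(\<Prod>k<N. c k) = d" using assms by (simp add: cyclic_presentation_def)
    ultimately show False using d2 by linarith
  qed
qed

text \<open>
A submodule spanned by part of the basis is closed under \<open>\<alpha>\<close>, which carries every basis element to a
nonzero multiple of its successor; so with one basis element it contains the whole cycle.
\<close>

lemma presentation_irreducible:
  assumes pres: "cyclic_presentation M ms e c"
  shows "irreducible_zplus_module R xs M ms"
proof -
  note P = presentation_facts[OF pres]
  interpret module R M by (rule P(1))
  have "H = {\<zero>\<^bsub>M\<^esub>} \<or> H = carrier M" if sub: "zplus_submodule R M ms H" for H
  proof -
    obtain T where T: "T \<subseteq> set ms" and H: "H = zspan M T" and sm: "submodule H R M"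
      using sub unfolding zplus_submodule_def by blast
    show ?thesis
    proof (cases "T = {}")
      case True
      thus ?thesis by (simp add: H M.zspan_empty)
    next
      case False
      then obtain k where k: "k < N" "e k \<in> T" using T P(7) by (metis ex_in_conv imageE lessThan_iff subsetD)
      have TS: "finite T" "T \<subseteq> carrier M" using T P(3,4) finite_subset by auto
      have orbit: "e ((k + j) mod N) \<in> T" for j
      proof (induction j)
        case 0
        then show ?case using k by simp
      next
        case (Suc j)
        let ?i = "(k + j) mod N"
        have i: "?i < N" using N0 by simp
        have "e ?i \<in> H" unfolding H by (rule M.zspan_base[OF TS Suc])
        hence "\<alpha> \<odot>\<^bsub>M\<^esub> e ?i \<in> H" using submodule.smult_closed[OF sm \<alpha>_in_R] by blast
        hence "[int (c ?i)] \<cdot>\<^bsub>M\<^esub> e (Suc ?i mod N) \<in> zspan M T" using P(9)[OF i] by (simp add: H)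
        moreover have "e (Suc ?i mod N) \<in> set ms" using P(5) N0 by simp
        ultimately have "e (Suc ?i mod N) \<in> T"
          using M.zbasis_span_subset[OF P(2) T, of "e (Suc ?i mod N)" "int (c ?i)"] P(10)[OF i] by simp
        thus ?case by (simp add: mod_Suc_eq)
      qed
      have "set ms \<subseteq> T"
      proof
        fix m assume "m \<in> set ms"
        then obtain i where i: "i < N" "m = e i" using P(7) by auto
        have "(k + (N - k + i)) mod N = i" using k i by simp
        thus "m \<in> T" using orbit[of "N - k + i"] i by simp
      qed
      hence "T = set ms" using T by blast
      thus ?thesis using P(2) by (simp add: H zbasis_def)
    qed
  qed
  thus ?thesis using pres unfolding irreducible_zplus_module_def cyclic_presentation_def by blast
qed

text \<open>
Matching the starting point of one cycle with a position \<open>s\<close> on the other one forces everything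
else, because the action of \<open>\<alpha>\<close> determines both the successor and the multiplier.
\<close>

lemma presentation_unique:
  assumes pres: "cyclic_presentation M ms e c" and pres': "cyclic_presentation M ms e' c'"
  obtains s where "s < N" "\<And>k. k < N \<Longrightarrow> c' k = c ((s + k) mod N)"
proof -
  note P = presentation_facts[OF pres] and P' = presentation_facts[OF pres']
  interpret module R M by (rule P(1))
  obtain s where s: "s < N" "e' 0 = e s" using P'(5)[OF N0] P(7) by (metis imageE lessThan_iff)
  have step: "e' (Suc j mod N) = e (Suc i mod N) \<and> c' j = c i"
    if "e' j = e i" "i < N" "j < N" for i j
  proof -
    have eq: "[int (c' j)] \<cdot>\<^bsub>M\<^esub> e' (Suc j mod N) = [int (c i)] \<cdot>\<^bsub>M\<^esub> e (Suc i mod N)"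
      using P(9)[of i] P'(9)[of j] that by simp
    have mem: "e' (Suc j mod N) \<in> set ms" "e (Suc i mod N) \<in> set ms" using P(5) P'(5) N0 by simp_all
    have "int (c' j) \<noteq> 0" using P'(10) that by simp
    from M.zbasis_zmult_eq[OF P(2) mem eq this] show ?thesis by simp
  qed
  have ee: "e' (k mod N) = e ((s + k) mod N)" for k
  proof (induction k)
    case 0
    then show ?case using s by simp
  next
    case (Suc k)
    have "e' (Suc (k mod N) mod N) = e (Suc ((s + k) mod N) mod N)"
      using step[OF Suc] N0 by simp
    thus ?case by (simp add: mod_Suc_eq)
  qed
  have "c' k = c ((s + k) mod N)" if "k < N" for k
    using step[of k "(s + k) mod N"] ee[of k] that N0 by simp
  thus ?thesis using that s by blast
qed

text \<open>
Sending \<open>e k\<close> to \<open>e' k\<close> extends to a homomorphism commuting with \<open>\<alpha>\<close>, hence with the whole ring.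
\<close>

lemma presentation_iso:
  assumes pres: "cyclic_presentation M ms e c" and pres': "cyclic_presentation M' ms' e' c'"
    and cc: "\<And>k. k < N \<Longrightarrow> c' k = c k"
  shows "zplus_isomorphic R xs M ms M' ms'"
proof -
  note P = presentation_facts[OF pres] and P' = presentation_facts[OF pres']
  interpret M: module R M by (rule P(1))
  interpret M': module R M' by (rule P'(1))
  define \<tau> where "\<tau> m = e' (inv_into {..<N} e m)" for m
  have \<tau>e: "\<tau> (e k) = e' k" if "k < N" for k using P(8) that by (simp add: \<tau>_def)
  have \<tau>_bij: "bij_betw \<tau> (set ms) (set ms')"
  proof -
    have "bij_betw (e' \<circ> inv_into {..<N} e) (set ms) (set ms')"
      using pres pres' by (intro bij_betw_trans[OF bij_betw_inv_into]) (auto simp: cyclic_presentation_def)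
    thus ?thesis by (simp add: \<tau>_def[abs_def] o_def)
  qed
  have "\<tau> \<in> set ms \<rightarrow> carrier M'" using \<tau>_bij P'(4) by (auto simp: bij_betw_def)
  then obtain \<psi> where hom: "\<psi> \<in> hom (add_monoid M) (add_monoid M')"
    and \<psi>: "\<And>m. m \<in> set ms \<Longrightarrow> \<psi> m = \<tau> m"
    using M.M.zbasis_hom_extension[OF P(2) M'.M.abelian_group_axioms] by blast
  have cl: "\<psi> x \<in> carrier M'" and add: "y \<in> carrier M \<Longrightarrow> \<psi> (x \<oplus>\<^bsub>M\<^esub> y) = \<psi> x \<oplus>\<^bsub>M'\<^esub> \<psi> y"
    if "x \<in> carrier M" for x y using hom that by (auto simp: hom_def)
  interpret h: group_hom "add_monoid M" "add_monoid M'" \<psi>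
    using hom by unfold_locales (auto simp: hom_def)
  have \<psi>_zmult: "\<psi> ([(b::int)] \<cdot>\<^bsub>M\<^esub> x) = [b] \<cdot>\<^bsub>M'\<^esub> \<psi> x" if "x \<in> carrier M" for b x
    using h.hom_int_pow[of x b] that by (simp add: add_pow_def)
  have \<alpha>c: "\<psi> (\<alpha> \<odot>\<^bsub>M\<^esub> x) = \<alpha> \<odot>\<^bsub>M'\<^esub> \<psi> x" if x: "x \<in> carrier M" for x
  proof (rule M.M.hom_ext_zbasis[OF P(2) M'.M.abelian_group_axioms _ _ _ x,
        of "\<lambda>x. \<psi> (\<alpha> \<odot>\<^bsub>M\<^esub> x)" "\<lambda>x. \<alpha> \<odot>\<^bsub>M'\<^esub> \<psi> x"])
    show "(\<lambda>x. \<psi> (\<alpha> \<odot>\<^bsub>M\<^esub> x)) \<in> hom (add_monoid M) (add_monoid M')"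
      by (rule homI) (auto simp: cl add M.smult_r_distr)
    show "(\<lambda>x. \<alpha> \<odot>\<^bsub>M'\<^esub> \<psi> x) \<in> hom (add_monoid M) (add_monoid M')"
      by (rule homI) (auto simp: cl add M'.smult_r_distr)
    fix m assume "m \<in> set ms"
    then obtain k where k: "k < N" "m = e k" using P(7) by auto
    have k': "Suc k mod N < N" using N0 by simp
    have "\<psi> (\<alpha> \<odot>\<^bsub>M\<^esub> m) = [int (c k)] \<cdot>\<^bsub>M'\<^esub> \<psi> (e (Suc k mod N))"
      using k k' by (simp add: P \<psi>_zmult)
    also have "\<dots> = \<alpha> \<odot>\<^bsub>M'\<^esub> e' k" using k k' by (simp add: P'(9) cc \<psi> P(5) \<tau>e)
    also have "e' k = \<psi> m" using k by (simp add: \<psi> P(5) \<tau>e)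
    finally show "\<psi> (\<alpha> \<odot>\<^bsub>M\<^esub> m) = \<alpha> \<odot>\<^bsub>M'\<^esub> \<psi> m" .
  qed
  have rc: "\<psi> (r \<odot>\<^bsub>M\<^esub> x) = r \<odot>\<^bsub>M'\<^esub> \<psi> x" if r: "r \<in> carrier R" and x: "x \<in> carrier M" for r x
    using r
  proof (induction r rule: R_induct)
    case zero
    show ?case using M.smult_l_null[OF x] M'.smult_l_null[OF cl[OF x]] h.hom_one by simp
  next
    case (horner b r)
    have rx: "r \<odot>\<^bsub>M\<^esub> x \<in> carrier M" using horner x by simp
    show ?case
      unfolding smult_horner[OF P(1) x horner(1)] smult_horner[OF P'(1) cl[OF x] horner(1)]
      using rx x by (simp add: add \<psi>_zmult \<alpha>c horner.IH)
  qed
  have len: "length ms = N" "length ms' = N" "distinct ms" "distinct ms'"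
    using P(2,7,8) P'(2,7,8) card_image[of e "{..<N}"] card_image[of e' "{..<N}"]
    by (auto simp: zbasis_def distinct_card)
  have nth: "bij_betw ((!) ms) {..<N} (set ms)" "bij_betw ((!) ms') {..<N} (set ms')"
    using len by (auto intro!: bij_betw_nth)
  define \<sigma> where "\<sigma> i = (if i < N then inv_into {..<N} ((!) ms') (\<tau> (ms ! i)) else i)" for i
  have "bij_betw (inv_into {..<N} ((!) ms') \<circ> (\<tau> \<circ> (!) ms)) {..<N} {..<N}"
    by (intro bij_betw_trans[OF bij_betw_trans[OF nth(1) \<tau>_bij]] bij_betw_inv_into nth)
  hence "bij_betw \<sigma> {..<N} {..<N}"
    by (rule bij_betw_cong[THEN iffD1, rotated]) (simp add: \<sigma>_def)
  hence "\<sigma> permutes {..<N}" by (rule bij_imp_permutes) (simp add: \<sigma>_def)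
  moreover have "\<psi> (ms ! i) = ms' ! \<sigma> i" if "i < N" for i
  proof -
    have "ms ! i \<in> set ms" using that len by simp
    hence "\<tau> (ms ! i) \<in> set ms'" using \<tau>_bij by (auto simp: bij_betw_def)
    hence "ms' ! \<sigma> i = \<tau> (ms ! i)"
      using that nth(2) by (simp add: \<sigma>_def bij_betw_inv_into_right)
    thus ?thesis using \<psi> \<open>ms ! i \<in> set ms\<close> by simp
  qed
  moreover have "zplus_module R xs M ms" "zplus_module R xs M' ms'"
    using pres pres' by (auto simp: cyclic_presentation_def)
  ultimately show ?thesis
    unfolding zplus_isomorphic_def using hom rc len(1,2)
    by (intro conjI exI[of _ \<psi>] exI[of _ \<sigma>]) auto
qed

text \<open>
An isomorphism permutes the bases, so it carries the cycle of one module to a cycle of the other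
with the same multipliers.
\<close>

lemma presentation_transfer:
  assumes iso: "zplus_isomorphic R xs M ms M' ms'" and pres: "cyclic_presentation M ms e c"
  obtains e' where "cyclic_presentation M' ms' e' c"
proof -
  note P = presentation_facts[OF pres]
  obtain \<psi> \<sigma> where z': "zplus_module R xs M' ms'" and len: "length ms = length ms'"
    and hom: "\<psi> \<in> hom (add_monoid M) (add_monoid M')"
    and lin: "\<And>r m. r \<in> carrier R \<Longrightarrow> m \<in> carrier M \<Longrightarrow> \<psi> (r \<odot>\<^bsub>M\<^esub> m) = r \<odot>\<^bsub>M'\<^esub> \<psi> m"
    and \<sigma>: "\<sigma> permutes {..<length ms}" and \<psi>: "\<And>i. i < length ms \<Longrightarrow> \<psi> (ms ! i) = ms' ! \<sigma> i"
    using iso unfolding zplus_isomorphic_def by blast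
  interpret M: module R M by (rule P(1))
  interpret M': module R M' using z' by (simp add: zplus_module_def)
  interpret h: group_hom "add_monoid M" "add_monoid M'" \<psi>
    using hom by unfold_locales (auto simp: hom_def)
  have dist: "distinct ms" "distinct ms'" using P(2) z' by (auto simp: zbasis_def zplus_module_def)
  let ?n = "length ms"
  have nth: "bij_betw ((!) ms) {..<?n} (set ms)" "bij_betw ((!) ms') {..<?n} (set ms')"
    using dist len by (auto intro!: bij_betw_nth)
  have "bij_betw ((!) ms' \<circ> \<sigma>) {..<?n} (set ms')"
    using bij_betw_trans[OF permutes_imp_bij[OF \<sigma>] nth(2)] .
  hence "bij_betw (\<psi> \<circ> (!) ms) {..<?n} (set ms')"
    by (rule bij_betw_cong[THEN iffD1, rotated]) (simp add: \<psi>)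
  hence "bij_betw \<psi> (set ms) (set ms')" using nth(1) bij_betw_comp_iff by blast
  hence "bij_betw (\<psi> \<circ> e) {..<N} (set ms')"
    using pres bij_betw_trans by (auto simp: cyclic_presentation_def)
  moreover have "\<alpha> \<odot>\<^bsub>M'\<^esub> (\<psi> \<circ> e) k = [int (c k)] \<cdot>\<^bsub>M'\<^esub> (\<psi> \<circ> e) (Suc k mod N)" if k: "k < N" for k
  proof -
    have k': "Suc k mod N < N" using N0 by simp
    have "\<alpha> \<odot>\<^bsub>M'\<^esub> \<psi> (e k) = \<psi> ([int (c k)] \<cdot>\<^bsub>M\<^esub> e (Suc k mod N))"
      using lin[of \<alpha> "e k"] P(6)[OF k] P(9)[OF k] by simp
    also have "\<dots> = [int (c k)] \<cdot>\<^bsub>M'\<^esub> \<psi> (e (Suc k mod N))"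
      using h.hom_int_pow[of "e (Suc k mod N)" "int (c k)"] P(6)[OF k'] by (simp add: add_pow_def)
    finally show ?thesis by simp
  qed
  ultimately show ?thesis
    using that[of "\<psi> \<circ> e"] pres z' unfolding cyclic_presentation_def by blast
qed

section \<open>Irreducible modules are cyclic\<close>

text \<open>
The number \<open>q\<close> is prescribed to divide the multiplier at the starting point, which normalises the
rotation: some multiplier along the cycle is divisible by \<open>q\<close>, and the cycle is entered there.
\<close>

lemma irreducible_presentation:
  fixes M :: "(real, 'b) module"
  assumes irr: "irreducible_zplus_module R xs M ms" and q: "prime q" "q dvd d"
  obtains e c where "cyclic_presentation M ms e c" "q dvd c 0"
proof -
  have zm: "zplus_module R xs M ms" and
    irr': "\<And>H. zplus_submodule R M ms H \<Longrightarrow> H = {\<zero>\<^bsub>M\<^esub>} \<or> H = carrier M"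
    using irr by (auto simp: irreducible_zplus_module_def)
  have mod: "module R M" and basis: "zbasis M ms" and "ms \<noteq> []"
    and pos: "\<And>x m. x \<in> set xs \<Longrightarrow> m \<in> set ms \<Longrightarrow> \<exists>a :: 'b \<Rightarrow> nat. x \<odot>\<^bsub>M\<^esub> m = zcomb M (\<lambda>z. int (a z)) (set ms)"
    using zm by (auto simp: zplus_module_def)
  interpret module R M by fact
  have S: "finite (set ms)" "set ms \<subseteq> carrier M" using basis by (auto simp: zbasis_def)
  have "\<alpha> ^ i \<in> carrier R" for i by (induction i) (auto simp: R_mult_closed)
  note pow_R = this
  have \<alpha>_xs: "\<alpha> \<in> set xs" "\<alpha> ^ (N - 1) \<in> set xs"
    unfolding set_xs using N2 by (auto intro: image_eqI[of _ _ 1])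
  have "\<alpha> \<otimes>\<^bsub>R\<^esub> \<alpha> ^ (N - 1) = of_int (int d)"
    using \<alpha>_pow_N N0 by (simp add: power_eq_if del: real_root_pow_pos2)
  hence prod_d: "\<alpha> \<otimes>\<^bsub>R\<^esub> \<alpha> ^ (N - 1) = [int d] \<cdot>\<^bsub>R\<^esub> \<one>\<^bsub>R\<^esub>"
    using R_one_zmult[of "int d"] by (simp only:)
  obtain \<pi> and a :: "'b \<Rightarrow> nat"
    where \<pi>a: "\<And>m. m \<in> set ms \<Longrightarrow> \<alpha> \<odot>\<^bsub>M\<^esub> m = [int (a m)] \<cdot>\<^bsub>M\<^esub> \<pi> m"
      and \<pi>S: "\<And>m. m \<in> set ms \<Longrightarrow> \<pi> m \<in> set ms" and inj: "inj_on \<pi> (set ms)"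
  proof (rule smult_monomial[OF basis \<alpha>_in_R pow_R prod_d])
    show "0 < d" using d2 by simp
    show "\<exists>a :: 'b \<Rightarrow> nat. \<alpha> \<odot>\<^bsub>M\<^esub> m = zcomb M (\<lambda>z. int (a z)) (set ms)"
      and "\<exists>a :: 'b \<Rightarrow> nat. (\<alpha> ^ (N - 1)) \<odot>\<^bsub>M\<^esub> m = zcomb M (\<lambda>z. int (a z)) (set ms)"
      if "m \<in> set ms" for m
      by (fact pos[OF \<alpha>_xs(1) that], fact pos[OF \<alpha>_xs(2) that])
  qed (rule that)
  have orbS: "(\<pi> ^^ k) m \<in> set ms" if "m \<in> set ms" for k m
    using that by (induction k) (auto simp: \<pi>S)
  have powact: "(\<alpha> ^ k) \<odot>\<^bsub>M\<^esub> m = [int (\<Prod>j<k. a ((\<pi> ^^ j) m))] \<cdot>\<^bsub>M\<^esub> (\<pi> ^^ k) m"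
    if m: "m \<in> set ms" for k m
  proof (induction k)
    case 0
    have "m \<in> carrier M" using m S by auto
    thus ?case using smult_one[of m] by (simp add: M.zmult_one)
  next
    case (Suc k)
    let ?p = "\<Prod>j<k. a ((\<pi> ^^ j) m)"
    have c: "m \<in> carrier M" "(\<pi> ^^ k) m \<in> carrier M" "(\<pi> ^^ Suc k) m \<in> carrier M"
      using orbS[OF m, of k] orbS[OF m, of "Suc k"] m S by auto
    have "(\<alpha> ^ Suc k) \<odot>\<^bsub>M\<^esub> m = \<alpha> \<odot>\<^bsub>M\<^esub> ((\<alpha> ^ k) \<odot>\<^bsub>M\<^esub> m)"
      using smult_assoc1[of \<alpha> "\<alpha> ^ k" m] c pow_R by simp
    also have "\<dots> = [int ?p] \<cdot>\<^bsub>M\<^esub> (\<alpha> \<odot>\<^bsub>M\<^esub> (\<pi> ^^ k) m)"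
      unfolding Suc by (rule smult_add_pow) (use c in auto)
    also have "\<dots> = [int ?p] \<cdot>\<^bsub>M\<^esub> ([int (a ((\<pi> ^^ k) m))] \<cdot>\<^bsub>M\<^esub> (\<pi> ^^ Suc k) m)"
      using \<pi>a[OF orbS[OF m, of k]] by simp
    also have "\<dots> = [int (\<Prod>j<Suc k. a ((\<pi> ^^ j) m))] \<cdot>\<^bsub>M\<^esub> (\<pi> ^^ Suc k) m"
      using c by (simp add: M.zmult_zmult)
    finally show ?case .
  qed
  have cyc: "(\<pi> ^^ N) m = m" "(\<Prod>j<N. a ((\<pi> ^^ j) m)) = d" if m: "m \<in> set ms" for m
  proof -
    have mM: "m \<in> carrier M" using m S by auto
    have "[int d] \<cdot>\<^bsub>M\<^esub> m = (\<alpha> ^ N) \<odot>\<^bsub>M\<^esub> m"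
      using smult_of_int[OF mod mM, of "int d"] by (simp only: \<alpha>_pow_N of_int_of_nat_eq)
    also have "\<dots> = [int (\<Prod>j<N. a ((\<pi> ^^ j) m))] \<cdot>\<^bsub>M\<^esub> (\<pi> ^^ N) m" by (rule powact[OF m])
    finally have eq: "[int d] \<cdot>\<^bsub>M\<^esub> m = [int (\<Prod>j<N. a ((\<pi> ^^ j) m))] \<cdot>\<^bsub>M\<^esub> (\<pi> ^^ N) m" .
    have "int d \<noteq> 0" using d2 by simp
    from M.zbasis_zmult_eq[OF basis m orbS[OF m] eq this]
    show "(\<pi> ^^ N) m = m" "(\<Prod>j<N. a ((\<pi> ^^ j) m)) = d" by (simp_all only: of_nat_eq_iff)
  qed
  obtain m1 where m1: "m1 \<in> set ms" using \<open>ms \<noteq> []\<close> by (cases ms) auto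
  have "q dvd (\<Prod>j<N. a ((\<pi> ^^ j) m1))" using cyc(2)[OF m1] q by simp
  then obtain j1 where j1: "q dvd a ((\<pi> ^^ j1) m1)" using q(1) by (auto simp: prime_dvd_prod_iff)
  define m0 where "m0 = (\<pi> ^^ j1) m1"
  have m0: "m0 \<in> set ms" using orbS m1 by (simp add: m0_def)
  define e where "e k = (\<pi> ^^ k) m0" for k
  have eS: "e k \<in> set ms" for k using orbS[OF m0] by (simp add: e_def)
  have e_Suc: "e (Suc k) = \<pi> (e k)" for k by (simp add: e_def)
  have e_N: "e (k + N) = e k" for k using cyc(1)[OF m0] by (simp add: e_def funpow_add)
  have e_mod: "e (k mod N) = e k" for k
  proof -
    have "e (k mod N + i * N) = e (k mod N)" for i
      by (induction i) (use e_N[of "k mod N + _ * N"] in \<open>auto simp: add_ac\<close>)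
    from this[of "k div N"] show ?thesis by simp
  qed
  have prod_e: "(\<Prod>j<N. a (e j)) = d" using cyc(2)[OF m0] by (simp add: e_def)
  \<comment> \<open>As \<open>\<pi>\<close> is injective, a coincidence on the orbit can be shifted back to
    the starting point.\<close>
  have cancel: "e 0 = e t" if "e k = e (t + k)" for k t
    using that
  proof (induction k)
    case (Suc k)
    hence "\<pi> (e k) = \<pi> (e (t + k))" by (simp add: e_Suc)
    hence "e k = e (t + k)" using inj eS by (meson inj_onD)
    thus ?case by (rule Suc.IH)
  qed simp
  have e_inj: "inj_on e {..<N}"
  proof (rule linorder_inj_onI)
    fix i j assume ij: "i < j" "i \<in> {..<N}" "j \<in> {..<N}"
    show "e i \<noteq> e j"
    proof
      assume "e i = e j"
      hence e0: "e 0 = e (j - i)" using cancel[of i "j - i"] ij by simp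
      define t where "t = j - i"
      have t: "0 < t" "t < N" using ij by (auto simp: t_def)
      have per: "e (k + t) = e k" for k using e0 by (induction k) (auto simp: e_Suc t_def)
      have "q dvd a (e 0)" using j1 by (simp add: e_def m0_def)
      \<comment> \<open>The orbit would have period \<open>t < N\<close>, so the multiplier at \<open>0\<close>
        would recur at position \<open>t\<close>.\<close>
      hence "q dvd a (e t)" "q dvd a (e 0)" using per[of 0] by auto
      hence "q * q dvd a (e 0) * a (e t)" by (simp add: mult_dvd_mono)
      also have "a (e 0) * a (e t) = (\<Prod>j\<in>{0, t}. a (e j))" using t by simp
      also have "\<dots> dvd (\<Prod>j<N. a (e j))" using t by (intro prod_dvd_prod_subset) auto
      finally have "q ^ 2 dvd d" by (simp add: prod_e power2_eq_square)
      hence "q dvd 1" using squarefreeD[OF sqf] by blast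
      thus False using q by auto
    qed
  qed auto
  define T where "T = e ` {..<N}"
  have T: "T \<subseteq> set ms" "finite T" "T \<subseteq> carrier M" using eS S by (auto simp: T_def)
  have eT: "e k \<in> T" for k
    unfolding T_def using e_mod[of k] N0 by (metis imageI lessThan_iff mod_less_divisor)
  let ?H = "zspan M T"
  have HM: "x \<in> ?H \<Longrightarrow> x \<in> carrier M" for x using M.zspan_closed[OF T(3)] by auto
  have \<alpha>H: "\<alpha> \<odot>\<^bsub>M\<^esub> x \<in> ?H" if xH: "x \<in> ?H" for x
  proof -
    obtain b where x: "x = zcomb M b T" using xH unfolding zspan_def by blast
    have "[b s] \<cdot>\<^bsub>M\<^esub> (\<alpha> \<odot>\<^bsub>M\<^esub> s) \<in> ?H" if sT: "s \<in> T" for s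
    proof -
      obtain k where k: "s = e k" using sT by (auto simp: T_def)
      have "\<alpha> \<odot>\<^bsub>M\<^esub> s = [int (a s)] \<cdot>\<^bsub>M\<^esub> e (Suc k)" using \<pi>a[OF eS] by (simp add: k e_Suc)
      thus ?thesis using T eT by (simp add: M.zspan_zmult M.zspan_base)
    qed
    thus ?thesis unfolding x smult_zcomb[OF \<alpha>_in_R T(2,3)]
      by (intro M.zspan_finsum T)
  qed
  have "submodule ?H R M"
  proof (rule submoduleI)
    fix r x assume r: "r \<in> carrier R" and x: "x \<in> ?H"
    show "r \<odot>\<^bsub>M\<^esub> x \<in> ?H"
      using r
    proof (induction r rule: R_induct)
      case zero
      show ?case using smult_l_null[of x] x HM T by (simp add: M.zspan_zero)
    next
      case (horner b r)
      show ?case unfolding smult_horner[OF mod HM[OF x] horner(1)]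
        by (intro M.zspan_add M.zspan_zmult T x \<alpha>H horner.IH)
    qed
  qed (use T in \<open>auto intro: M.zspan_zero M.zspan_add M.zspan_uminus HM\<close>)
  hence "zplus_submodule R M ms ?H" using T by (auto simp: zplus_submodule_def)
  moreover have "e 0 \<in> ?H" using T eT by (simp add: M.zspan_base)
  moreover have "e 0 \<noteq> \<zero>\<^bsub>M\<^esub>" by (rule M.zbasis_nonzero[OF basis eS])
  ultimately have HC: "?H = carrier M" using irr' by blast
  have "set ms \<subseteq> T"
  proof
    fix m assume m: "m \<in> set ms"
    hence "[(1::int)] \<cdot>\<^bsub>M\<^esub> m \<in> ?H" using HC S by auto
    thus "m \<in> T" using M.zbasis_span_subset[OF basis T(1) m] by simp
  qed
  hence "bij_betw e {..<N} (set ms)" using e_inj T(1) by (auto simp: bij_betw_def T_def)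
  moreover have "\<alpha> \<odot>\<^bsub>M\<^esub> e k = [int (a (e k))] \<cdot>\<^bsub>M\<^esub> e (Suc k mod N)" for k
    using \<pi>a[OF eS] by (simp add: e_mod e_Suc)
  ultimately have "cyclic_presentation M ms e (\<lambda>k. a (e k))"
    using zm prod_e by (simp add: cyclic_presentation_def)
  moreover have "q dvd a (e 0)" using j1 by (simp add: e_def m0_def)
  ultimately show ?thesis using that by blast
qed

section \<open>Existence of cyclic modules\<close>

lemma L_gen_eq:
  assumes "(\<Prod>i=1..N. c i) = d"
  shows "L_gen N c k = 1 / (\<Prod>i=1..k. real (c i)) * \<alpha> ^ k * L_v N c"
  unfolding L_gen_def assms ..

text \<open>
Up to the common factor \<open>L_v N c\<close>, the generators are the powers of \<open>\<alpha>\<close> divided by partial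
products of \<open>c\<close>. Multiplication by \<open>d\<close> replaces these denominators by the complementary
products and so leads back to an integer relation between the powers of \<open>\<alpha>\<close>.
\<close>

lemma L_gen_independent:
  fixes c :: "nat \<Rightarrow> nat" and a :: "nat \<Rightarrow> int"
  assumes pos: "\<And>i. i \<in> {1..N} \<Longrightarrow> c i > 0" and prod: "(\<Prod>i=1..N. c i) = d"
    and sum: "(\<Sum>k<N. of_int (a k) * L_gen N c k) = 0"
  shows "\<forall>k<N. a k = 0"
proof -
  have v: "L_v N c \<noteq> 0"
  proof -
    have "c (N - i) > 0" if "i \<in> {1..N - 1}" for i using pos that by auto
    thus ?thesis unfolding L_v_def using N0 by fastforce
  qed
  have split: "real (\<Prod>i=k+1..N. c i) / real d = 1 / (\<Prod>i=1..k. real (c i))" if "k < N" for k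
  proof -
    have "{1..N} = {1..k} \<union> {k+1..N}" using that by auto
    hence "real d = (\<Prod>i=1..k. real (c i)) * real (\<Prod>i=k+1..N. c i)"
      unfolding prod[symmetric] by (simp add: prod.union_disjoint)
    moreover have "(\<Prod>i=k+1..N. c i) > 0" by (intro prod_pos ballI pos) auto
    ultimately show ?thesis by (simp add: field_simps del: of_nat_prod)
  qed
  define b where "b k = a k * int (\<Prod>i=k+1..N. c i)" for k
  have "(\<Sum>k<N. of_int (b k) * \<alpha> ^ k) = real d / L_v N c * (\<Sum>k<N. of_int (a k) * L_gen N c k)"
  proof -
    have "of_int (b k) * \<alpha> ^ k = real d / L_v N c * (of_int (a k) * L_gen N c k)" if "k < N" for k
      using v d2 split[OF that, symmetric]
      by (simp add: L_gen_eq[OF prod] b_def del: of_nat_prod)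
    thus ?thesis unfolding sum_distrib_left by (intro sum.cong) auto
  qed
  hence "\<forall>k<N. b k = 0" using sum by (intro independent) simp
  moreover have "(\<Prod>i=k+1..N. c i) > 0" for k by (intro prod_pos ballI pos) auto
  ultimately show ?thesis by (metis b_def less_numeral_extra(3) mult_eq_0_iff of_nat_eq_0_iff)
qed

text \<open>
Each step introduces the next factor of \<open>c\<close> in the denominator; the last one wraps around because
\<open>\<alpha> ^ N = d\<close> cancels all but the factor \<open>c N\<close>.
\<close>

lemma L_gen_step:
  fixes c :: "nat \<Rightarrow> nat"
  assumes pos: "\<And>i. i \<in> {1..N} \<Longrightarrow> c i > 0" and prod: "(\<Prod>i=1..N. c i) = d" and k: "k < N"
  shows "\<alpha> * L_gen N c k = real (c (Suc k)) * L_gen N c (Suc k mod N)"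
proof (cases "Suc k = N")
  case False
  hence "Suc k mod N = Suc k" using k by simp
  moreover have "c (Suc k) > 0" using pos k by simp
  moreover have "(\<Prod>i=1..Suc k. real (c i)) = (\<Prod>i=1..k. real (c i)) * real (c (Suc k))" by simp
  ultimately show ?thesis unfolding L_gen_eq[OF prod] by simp
next
  case True
  have ck: "c (Suc k) > 0" using pos k by simp
  have "real (c (Suc k)) * (\<Prod>i=1..k. real (c i)) = real d"
    using arg_cong[OF prod, of real] unfolding True[symmetric] by (simp add: mult.commute)
  moreover have "(\<Prod>i=1..k. real (c i)) \<noteq> 0" using pos k by fastforce
  ultimately have "real d / (\<Prod>i=1..k. real (c i)) = real (c (Suc k))" by (simp add: field_simps)
  moreover have "\<alpha> * \<alpha> ^ k = real d" using \<alpha>_pow_N True by (metis power_Suc)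
  hence "\<alpha> * L_gen N c k = real d / (\<Prod>i=1..k. real (c i)) * L_v N c"
    by (simp add: L_gen_eq[OF prod])
  ultimately show ?thesis using True by (simp add: L_gen_eq[OF prod])
qed

lemma L_presentation:
  fixes c :: "nat \<Rightarrow> nat"
  assumes pos: "\<And>i. i \<in> {1..N} \<Longrightarrow> c i > 0" and prod: "(\<Prod>i=1..N. c i) = d"
  shows "cyclic_presentation (L_module N c) (L_basis N c) (L_gen N c) (\<lambda>k. c (Suc k))"
proof -
  let ?L = "L_module N c"
  have carr: "carrier ?L = {\<Sum>k<N. of_int (a k) * L_gen N c k |a. True}"
    unfolding L_module_def by (simp only: partial_object.select_convs)
  have [simp]: "add ?L = (+)" "zero ?L = 0" "module.smult ?L = (*)"
    unfolding L_module_def by (simp_all only: ring.select_convs module.select_convs)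
  have memI: "(\<Sum>k<N. of_int (a k) * L_gen N c k) \<in> carrier ?L" for a :: "nat \<Rightarrow> int"
    unfolding carr by (rule CollectI, rule exI[of _ a]) simp
  have add: "x + y \<in> carrier ?L" if xy: "x \<in> carrier ?L" "y \<in> carrier ?L" for x y
  proof -
    obtain a where x: "x = (\<Sum>k<N. of_int (a k) * L_gen N c k)" using xy(1) unfolding carr by blast
    obtain b where y: "y = (\<Sum>k<N. of_int (b k) * L_gen N c k)" using xy(2) unfolding carr by blast
    show ?thesis using memI[of "\<lambda>k. a k + b k"] by (simp add: x y sum.distrib distrib_right)
  qed
  have scale: "of_int b * x \<in> carrier ?L" if x: "x \<in> carrier ?L" for x b
  proof -
    obtain a where x: "x = (\<Sum>k<N. of_int (a k) * L_gen N c k)" using x unfolding carr by blast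
    show ?thesis using memI[of "\<lambda>k. b * a k"] by (simp add: x sum_distrib_left mult.assoc)
  qed
  have z0: "0 \<in> carrier ?L" using memI[of "\<lambda>_. 0"] by simp
  have neg: "- x \<in> carrier ?L" if "x \<in> carrier ?L" for x using scale[OF that, of "-1"] by simp
  have gen: "L_gen N c k \<in> carrier ?L" if "k < N" for k
  proof -
    have "L_gen N c k = (\<Sum>j<N. of_int (if j = k then 1 else 0) * L_gen N c j)"
      using that by (simp add: if_distrib[of "\<lambda>x. x * _"] if_distrib[of real_of_int] cong: if_cong)
    thus ?thesis using memI[of "\<lambda>j. if j = k then 1 else 0"] by (simp only:)
  qed
  have sum: "sum f T \<in> carrier ?L" if "finite T" "\<And>x. x \<in> T \<Longrightarrow> f x \<in> carrier ?L" for f and T :: "nat set"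
    using that by (induction T) (auto simp: z0 add)
  have \<alpha>: "\<alpha> * x \<in> carrier ?L" if x: "x \<in> carrier ?L" for x
  proof -
    obtain a where x: "x = (\<Sum>k<N. of_int (a k) * L_gen N c k)" using x unfolding carr by blast
    have "\<alpha> * x = (\<Sum>k<N. of_int (a k) * (of_int (int (c (Suc k))) * L_gen N c (Suc k mod N)))"
      unfolding x sum_distrib_left
    proof (rule sum.cong)
      fix k assume "k \<in> {..<N}"
      hence "\<alpha> * L_gen N c k = real (c (Suc k)) * L_gen N c (Suc k mod N)"
        by (intro L_gen_step pos prod) auto
      thus "\<alpha> * (of_int (a k) * L_gen N c k) = of_int (a k) * (of_int (int (c (Suc k))) * L_gen N c (Suc k mod N))"
        by (metis mult.left_commute of_int_of_nat_eq)
    qed simp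
    also have "\<dots> \<in> carrier ?L" using N0 by (intro sum scale gen) auto
    finally show ?thesis .
  qed
  have ab: "abelian_group ?L"
    by (rule abelian_groupI) (auto simp: add z0 intro!: bexI[of _ "- _"] neg)
  have closed: "r * x \<in> carrier ?L" if "r \<in> carrier R" "x \<in> carrier ?L" for r x
    using that(1)
  proof (induction r rule: R_induct)
    case zero
    then show ?case by (simp add: z0)
  next
    case (horner b r)
    have "(of_int b + \<alpha> * r) * x = of_int b * x + \<alpha> * (r * x)" by (simp add: algebra_simps)
    also have "\<dots> \<in> carrier ?L" by (intro add scale \<alpha> horner.IH that)
    finally show ?case .
  qed
  have mod: "module R ?L"
    by (rule moduleI[OF R_cring ab]) (auto simp: closed algebra_simps)
  have basis: "inj_on (L_gen N c) {..<N}" "zbasis ?L (L_basis N c)"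
    unfolding L_basis_def
    using real_zbasis[OF ab _ _ carr L_gen_independent[OF pos prod]] by simp_all
  have set: "set (L_basis N c) = L_gen N c ` {..<N}" by (auto simp: L_basis_def atLeast0LessThan)
  have step: "\<alpha> \<odot>\<^bsub>?L\<^esub> L_gen N c k = [int (c (Suc k))] \<cdot>\<^bsub>?L\<^esub> L_gen N c (Suc k mod N)" if "k < N" for k
  proof -
    have "[int (c (Suc k))] \<cdot>\<^bsub>?L\<^esub> L_gen N c (Suc k mod N) = of_int (int (c (Suc k))) * L_gen N c (Suc k mod N)"
      by (rule real_add_pow_int[OF ab]) (use N0 gen in auto)
    moreover have "\<alpha> * L_gen N c k = real (c (Suc k)) * L_gen N c (Suc k mod N)"
      by (rule L_gen_step) (use pos prod that in auto)
    ultimately show ?thesis by simp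
  qed
  have "zplus_module R xs ?L (L_basis N c)"
  proof (rule zplus_moduleI[OF mod basis(2)])
    show "L_basis N c \<noteq> []" using N0 by (simp add: L_basis_def)
    fix m assume "m \<in> set (L_basis N c)"
    then obtain k where k: "k < N" "m = L_gen N c k" by (auto simp: set)
    have "L_gen N c (Suc k mod N) \<in> set (L_basis N c)" using N0 by (simp add: set)
    thus "\<exists>n\<in>set (L_basis N c). \<exists>a :: nat. \<alpha> \<odot>\<^bsub>?L\<^esub> m = [int a] \<cdot>\<^bsub>?L\<^esub> n"
      using step[OF k(1)] k(2) by blast
  qed
  moreover have "(\<Prod>k<N. c (Suc k)) = d"
    using prod by (simp add: prod.atLeast1_atMost_eq)
  ultimately show ?thesis
    unfolding cyclic_presentation_def using basis(1) set step by (simp add: bij_betw_def)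
qed

text \<open>
Multiplication and unit of the record are left unspecified: a module involves only addition and the
action of scalars.
\<close>

definition transport :: "('b \<Rightarrow> 'c) \<Rightarrow> (real, 'b) module \<Rightarrow> (real, 'c) module" where
  "transport \<phi> M =
     (let \<gamma> = inv_into (carrier M) \<phi> in
      \<lparr>carrier = \<phi> ` carrier M, monoid.mult = undefined, one = undefined,
       zero = \<phi> \<zero>\<^bsub>M\<^esub>, add = (\<lambda>x y. \<phi> (\<gamma> x \<oplus>\<^bsub>M\<^esub> \<gamma> y)), module.smult = (\<lambda>r x. \<phi> (r \<odot>\<^bsub>M\<^esub> \<gamma> x))\<rparr>)"

lemma transport_presentation:
  fixes M :: "(real, 'b) module" and \<phi> :: "'b \<Rightarrow> 'c"
  assumes pres: "cyclic_presentation M ms e c" and inj: "inj_on \<phi> (carrier M)"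
  shows "cyclic_presentation (transport \<phi> M) (map \<phi> ms) (\<phi> \<circ> e) c"
proof -
  note P = presentation_facts[OF pres]
  interpret module R M by (rule P(1))
  let ?T = "transport \<phi> M"
  have inv: "inv_into (carrier M) \<phi> (\<phi> x) = x" if "x \<in> carrier M" for x
    using inj that by simp
  have carr: "carrier ?T = \<phi> ` carrier M" and zero: "\<zero>\<^bsub>?T\<^esub> = \<phi> \<zero>\<^bsub>M\<^esub>"
    by (simp_all add: transport_def Let_def)
  have add: "\<phi> x \<oplus>\<^bsub>?T\<^esub> \<phi> y = \<phi> (x \<oplus>\<^bsub>M\<^esub> y)" if "x \<in> carrier M" "y \<in> carrier M" for x y
    using that by (simp add: transport_def Let_def inv)
  have smult: "r \<odot>\<^bsub>?T\<^esub> \<phi> x = \<phi> (r \<odot>\<^bsub>M\<^esub> x)" if "x \<in> carrier M" for r x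
    using that by (simp add: transport_def Let_def inv)
  have ab: "abelian_group ?T"
  proof (rule abelian_groupI)
    fix x assume "x \<in> carrier ?T"
    then obtain x' where x': "x' \<in> carrier M" "x = \<phi> x'" by (auto simp: carr)
    show "\<exists>y\<in>carrier ?T. y \<oplus>\<^bsub>?T\<^esub> x = \<zero>\<^bsub>?T\<^esub>"
      using x' by (intro bexI[of _ "\<phi> (\<ominus>\<^bsub>M\<^esub> x')"]) (auto simp: add carr zero M.l_neg)
  qed (auto simp: carr add zero M.a_ac)
  have mod: "module R ?T"
    by (rule moduleI[OF R_cring ab]) (auto simp: carr add smult smult_l_distr smult_r_distr smult_assoc1
        simp del: R_simps)
  have hom: "\<phi> \<in> hom (add_monoid M) (add_monoid ?T)"
    by (rule homI) (auto simp: carr add)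
  interpret T: abelian_group ?T by fact
  interpret h: group_hom "add_monoid M" "add_monoid ?T" \<phi>
    using hom by unfold_locales (auto simp: hom_def)
  have zmult: "\<phi> ([(b::int)] \<cdot>\<^bsub>M\<^esub> x) = [b] \<cdot>\<^bsub>?T\<^esub> \<phi> x" if "x \<in> carrier M" for b x
    using h.hom_int_pow[of x b] that by (simp add: add_pow_def)
  have injS: "inj_on \<phi> (set ms)" using inj P(4) inj_on_subset by blast
  have sub: "\<phi> ` set ms \<subseteq> carrier ?T" using P(4) by (auto simp: carr)
  have comb: "zcomb ?T b (\<phi> ` set ms) = \<phi> (zcomb M (b \<circ> \<phi>) (set ms))" for b
  proof -
    have "zcomb ?T b (\<phi> ` set ms) = (\<Oplus>\<^bsub>?T\<^esub>x\<in>set ms. [b (\<phi> x)] \<cdot>\<^bsub>?T\<^esub> \<phi> x)"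
      unfolding zcomb_def by (rule T.finsum_reindex) (use sub injS in auto)
    thus ?thesis by (simp add: M.zcomb_hom[OF ab hom P(3,4)])
  qed
  have basis: "zbasis ?T (map \<phi> ms)"
    unfolding zbasis_def
  proof (intro conjI allI impI ballI)
    show "distinct (map \<phi> ms)" using P(2) injS by (simp add: distinct_map zbasis_def)
    show "set (map \<phi> ms) \<subseteq> carrier ?T" using sub by simp
    show "zspan ?T (set (map \<phi> ms)) = carrier ?T"
    proof
      show "zspan ?T (set (map \<phi> ms)) \<subseteq> carrier ?T" using T.zspan_closed[OF sub] by simp
      show "carrier ?T \<subseteq> zspan ?T (set (map \<phi> ms))"
      proof
        fix y assume "y \<in> carrier ?T"
        then obtain x where x: "x \<in> carrier M" "y = \<phi> x" by (auto simp: carr)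
        obtain b where b: "x = zcomb M b (set ms)" using M.zbasis_expand[OF P(2) x(1)] by blast
        have "zcomb M b (set ms) = zcomb M ((b \<circ> inv_into (set ms) \<phi>) \<circ> \<phi>) (set ms)"
          using injS by (intro M.zcomb_cong P(4)) simp
        hence "y = zcomb ?T (b \<circ> inv_into (set ms) \<phi>) (\<phi> ` set ms)"
          unfolding comb using x b by simp
        thus "y \<in> zspan ?T (set (map \<phi> ms))" using T.zspanI by simp
      qed
    qed
    fix b y assume 0: "zcomb ?T b (set (map \<phi> ms)) = \<zero>\<^bsub>?T\<^esub>" and y: "y \<in> set (map \<phi> ms)"
    have "\<phi> (zcomb M (b \<circ> \<phi>) (set ms)) = \<phi> \<zero>\<^bsub>M\<^esub>" using 0 by (simp add: comb zero)
    hence "zcomb M (b \<circ> \<phi>) (set ms) = \<zero>\<^bsub>M\<^esub>" using inj P(4) by (simp add: inj_on_def)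
    hence "\<forall>x\<in>set ms. (b \<circ> \<phi>) x = 0" using P(2) unfolding zbasis_def by blast
    thus "b y = 0" using y by auto
  qed
  have step: "\<alpha> \<odot>\<^bsub>?T\<^esub> \<phi> (e k) = [int (c k)] \<cdot>\<^bsub>?T\<^esub> \<phi> (e (Suc k mod N))" if "k < N" for k
    using that P(6)[of "Suc k mod N"] N0 by (simp add: smult P(6,9) zmult)
  have "zplus_module R xs ?T (map \<phi> ms)"
  proof (rule zplus_moduleI[OF mod basis])
    show "map \<phi> ms \<noteq> []" using pres by (auto simp: cyclic_presentation_def zplus_module_def)
    fix m assume "m \<in> set (map \<phi> ms)"
    then obtain x where "x \<in> e ` {..<N}" "m = \<phi> x" unfolding P(7) by auto
    then obtain k where k: "k < N" "m = \<phi> (e k)" by blast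
    have "\<phi> (e (Suc k mod N)) \<in> set (map \<phi> ms)" using N0 P(5) by simp
    thus "\<exists>n\<in>set (map \<phi> ms). \<exists>a :: nat. \<alpha> \<odot>\<^bsub>?T\<^esub> m = [int a] \<cdot>\<^bsub>?T\<^esub> n"
      using step[OF k(1)] k(2) by blast
  qed
  moreover have "bij_betw (\<phi> \<circ> e) {..<N} (set (map \<phi> ms))"
    using bij_betw_trans[of e "{..<N}" "set ms" \<phi> "\<phi> ` set ms"] pres injS
    by (simp add: cyclic_presentation_def bij_betw_def)
  ultimately show ?thesis using pres step by (simp add: cyclic_presentation_def)
qed

text \<open>
Needed to place the carrier inside an arbitrary infinite type.
\<close>

lemma countable_carrier:
  assumes "cyclic_presentation M ms e c"
  shows "countable (carrier M)"
proof -
  note P = presentation_facts[OF assms]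
  interpret module R M by (rule P(1))
  have "carrier M \<subseteq> (\<lambda>l. zcomb M (\<lambda>x. case map_of (zip ms l) x of None \<Rightarrow> 0 | Some y \<Rightarrow> y) (set ms)) ` (UNIV :: int list set)"
  proof
    fix x assume "x \<in> carrier M"
    then obtain a where a: "x = zcomb M a (set ms)" using M.zbasis_expand[OF P(2)] by blast
    have "x = zcomb M (\<lambda>x. case map_of (zip ms (map a ms)) x of None \<Rightarrow> 0 | Some y \<Rightarrow> y) (set ms)"
      unfolding a by (intro M.zcomb_cong P(4)) (simp add: map_of_zip_map)
    thus "x \<in> (\<lambda>l. zcomb M (\<lambda>x. case map_of (zip ms l) x of None \<Rightarrow> 0 | Some y \<Rightarrow> y) (set ms)) ` UNIV"
      by blast
  qed
  thus ?thesis by (rule countable_subset) simp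
qed

lemma presentation_exists:
  assumes inf: "infinite (UNIV :: 'b set)" and prod: "(\<Prod>k<N. c k) = d"
  obtains M :: "(real, 'b) module" and ms e where "cyclic_presentation M ms e c"
proof -
  let ?c = "\<lambda>i. c (i - 1)"
  have pos: "?c i > 0" if "i \<in> {1..N}" for i
  proof (rule ccontr)
    assume "\<not> ?c i > 0"
    hence "(\<Prod>k<N. c k) = 0" using that by (intro prod_zero) (auto intro!: bexI[of _ "i - 1"])
    thus False using prod d2 by simp
  qed
  have "(\<Prod>i=1..N. ?c i) = d"
    using prod by (simp add: prod.atLeast1_atMost_eq)
  hence L: "cyclic_presentation (L_module N ?c) (L_basis N ?c) (L_gen N ?c) c"
    using L_presentation[of ?c] pos by simp
  have cnt: "countable (carrier (L_module N ?c))" by (rule countable_carrier[OF L])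
  obtain h :: "nat \<Rightarrow> 'b" where h: "inj h"
    using infinite_countable_subset[OF inf] by blast
  have "inj_on (h \<circ> to_nat_on (carrier (L_module N ?c))) (carrier (L_module N ?c))"
    using inj_on_to_nat_on[OF cnt] h by (intro comp_inj_on) (auto intro: inj_on_subset)
  from transport_presentation[OF L this] show ?thesis by (rule that)
qed

section \<open>Counting isomorphism classes\<close>

text \<open>
Presentations are carried along isomorphisms, and equal multipliers make modules isomorphic; so the
class of a cyclic module is read off from its multipliers alone.
\<close>

lemma isomorphism_class_eq:
  assumes pres: "cyclic_presentation M ms e c"
  shows "zplus_iso_rel R xs `` {(M, ms)} = {(M', ms'). \<exists>e'. cyclic_presentation M' ms' e' c}"
proof -
  have "zplus_isomorphic R xs M ms M' ms' \<longleftrightarrow> (\<exists>e'. cyclic_presentation M' ms' e' c)" for M' ms'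
    using presentation_transfer[OF _ pres] presentation_iso[OF pres] by metis
  thus ?thesis by (auto simp: zplus_iso_rel_def)
qed

lemma presentation_cong:
  assumes "cyclic_presentation M ms e c" "\<And>k. k < N \<Longrightarrow> c' k = c k"
  shows "cyclic_presentation M ms e c'"
  using assms by (simp add: cyclic_presentation_def)

end

lemma prod_distinct_primes_dvd:
  fixes p :: "'i \<Rightarrow> nat"
  assumes "finite I" "inj_on p I" "\<And>i. i \<in> I \<Longrightarrow> prime (p i)" "\<And>i. i \<in> I \<Longrightarrow> p i dvd n"
  shows "prod p I dvd n"
  using assms
proof (induction I)
  case (insert i I)
  have "coprime (p i) (prod p I)"
    using insert by (intro prod_coprime_right primes_coprime) auto
  moreover have "prod p I dvd n" using insert by auto
  ultimately show ?case using insert by (simp add: divides_mult)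
qed simp

locale factored_root =
  fixes d N m :: nat and p :: "nat \<Rightarrow> nat"
  assumes prime: "\<And>i. i \<in> {1..m} \<Longrightarrow> prime (p i)" and inj: "inj_on p {1..m}"
    and d_eq: "d = (\<Prod>i=1..m. p i)" and d_ge: "d \<ge> 2" and N_ge: "N \<ge> 2"
begin

sublocale squarefree_root d N
proof
  have "squarefree (\<Prod>i\<in>{1..m}. p i)"
  proof (rule squarefree_prod_coprime)
    fix a b assume "a \<in> {1..m}" "b \<in> {1..m}" "a \<noteq> b"
    thus "coprime (p a) (p b)" using prime inj by (intro primes_coprime) (auto dest: inj_onD)
  qed (use prime in \<open>auto intro: squarefree_prime\<close>)
  thus "squarefree d" by (simp add: d_eq)
qed (use d_ge N_ge in auto)

lemma m_pos: "1 \<in> {1..m}" using d_ge d_eq by (cases m) auto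

lemma p_dvd_d: "i \<in> {1..m} \<Longrightarrow> p i dvd d" by (auto simp: d_eq intro!: dvd_prodI)

text \<open>
The position of each prime among the factors, with the first prime at position \<open>0\<close>. This fixes
one rotation of every cyclic sequence.
\<close>

definition placements :: "(nat \<Rightarrow> nat) set" where
  "placements = (\<Pi>\<^sub>E i\<in>{1..m}. if i = 1 then {0} else {..<N})"

definition factors_of :: "(nat \<Rightarrow> nat) \<Rightarrow> nat \<Rightarrow> nat" where
  "factors_of f k = (\<Prod>i | i \<in> {1..m} \<and> f i = k. p i)"

lemma card_placements: "card placements = N ^ (m - 1)"
proof -
  have m: "{1..m} = insert 1 {2..m}" using m_pos by auto
  have "card placements = (\<Prod>i\<in>{1..m}. card (if i = 1 then {0} else {..<N}))"
    by (simp add: placements_def card_PiE)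
  also have "\<dots> = (\<Prod>i\<in>{2..m}. card (if i = 1 then {0} else {..<N}))"
    unfolding m by simp
  also have "\<dots> = (\<Prod>i\<in>{2..m}. N)" by (intro prod.cong) auto
  also have "\<dots> = N ^ (m - 1)" by simp
  finally show ?thesis .
qed

lemma placements_less:
  assumes "f \<in> placements" "i \<in> {1..m}" shows "f i < N"
proof -
  have "f i \<in> (if i = 1 then {0} else {..<N})"
    using PiE_mem[OF assms[unfolded placements_def]] .
  thus ?thesis using N0 by (auto split: if_splits)
qed

lemma placements_1: "f \<in> placements \<Longrightarrow> f 1 = 0"
  using PiE_mem[of f "{1..m}" _ 1] m_pos unfolding placements_def by fastforce

lemma prod_factors_of:
  assumes "f \<in> placements" shows "(\<Prod>k<N. factors_of f k) = d"
  unfolding factors_of_def d_eq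
  by (rule prod.group) (use placements_less[OF assms] in auto)

lemma p_dvd_factors_of:
  assumes "i \<in> {1..m}" shows "p i dvd factors_of f k \<longleftrightarrow> f i = k"
proof
  assume "p i dvd factors_of f k"
  then obtain j where j: "j \<in> {1..m}" "f j = k" "p i dvd p j"
    unfolding factors_of_def using prime[OF assms] by (auto simp: prime_dvd_prod_iff)
  hence "p i = p j" using prime assms by (simp add: primes_dvd_imp_eq)
  hence "i = j" using inj assms j by (auto dest: inj_onD)
  thus "f i = k" using j by simp
next
  assume "f i = k"
  thus "p i dvd factors_of f k" unfolding factors_of_def using assms by (intro dvd_prodI) auto
qed

text \<open>
Place each prime at a position whose entry it divides. The resulting factors divide those of \<open>c\<close>,
and as both sequences have product \<open>d\<close>, they agree.
\<close>

lemma factors_of_surj: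
  assumes prod: "(\<Prod>k<N. c k) = d" and c0: "p 1 dvd c 0"
  obtains f where "f \<in> placements" "\<And>k. k < N \<Longrightarrow> factors_of f k = c k"
proof -
  have "\<exists>k<N. p i dvd c k" if "i \<in> {1..m}" for i
    using p_dvd_d[OF that] prime[OF that] by (auto simp: prod[symmetric] prime_dvd_prod_iff)
  then obtain g where g: "\<And>i. i \<in> {1..m} \<Longrightarrow> g i < N \<and> p i dvd c (g i)" by metis
  define f where "f = (\<lambda>i\<in>{1..m}. if i = 1 then 0 else g i)"
  have f: "f \<in> placements" using g by (auto simp: f_def placements_def)
  have f_dvd: "p i dvd c (f i)" if "i \<in> {1..m}" for i using g c0 that by (auto simp: f_def)
  have dvd: "factors_of f k dvd c k" for k
    unfolding factors_of_def
    by (rule prod_distinct_primes_dvd) (use f_dvd prime inj in \<open>auto intro: inj_on_subset\<close>)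
  define q where "q k = c k div factors_of f k" for k
  have q: "c k = factors_of f k * q k" for k using dvd[of k] by (simp add: q_def)
  have "d * (\<Prod>k<N. q k) = d"
    using prod unfolding q prod.distrib prod_factors_of[OF f] .
  hence "(\<Prod>k<N. q k) = 1" using d_ge by simp
  hence "q k = 1" if "k < N" for k
    using dvd_prodI[of "{..<N}" k q] that by simp
  thus ?thesis using that[OF f] q by simp
qed

lemma irreducible_isomorphic_L_module:
  fixes M :: "(real, 'b) module"
  assumes irr: "irreducible_zplus_module R xs M ms"
  shows "\<exists>c. (\<forall>i\<in>{1..N}. 0 < c i \<and> c i dvd d) \<and> (\<Prod>i=1..N. c i) = d \<and>
           zplus_isomorphic R xs M ms (L_module N c) (L_basis N c)"
proof -
  obtain e c where pres: "cyclic_presentation M ms e c"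
    using irreducible_presentation[OF irr prime[OF m_pos] p_dvd_d[OF m_pos]] by blast
  note P = presentation_facts[OF pres]
  let ?c = "\<lambda>i. c (i - 1)"
  have prod: "(\<Prod>i=1..N. ?c i) = d"
    using pres by (simp add: cyclic_presentation_def prod.atLeast1_atMost_eq)
  have pos: "?c i > 0" if "i \<in> {1..N}" for i using P(10)[of "i - 1"] that by auto
  have "?c i dvd d" if "i \<in> {1..N}" for i
    unfolding prod[symmetric] using that by (intro dvd_prodI) auto
  moreover have "zplus_isomorphic R xs M ms (L_module N ?c) (L_basis N ?c)"
    by (rule presentation_iso[OF pres L_presentation[OF pos prod]]) auto
  ultimately show ?thesis using pos prod by (intro exI[of _ ?c]) auto
qed

text \<open>
A class corresponds to a placement. Two placements with the same class differ by a rotation; since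
the first prime divides only the factor at position \<open>0\<close> in both, the rotation is trivial.
\<close>

lemma card_isomorphism_classes:
  assumes inf: "infinite (UNIV :: 'b set)"
  shows "card ((irreducible_zplus_modules R xs :: ((real, 'b) module \<times> 'b list) set)
           // zplus_iso_rel R xs) = N ^ (m - 1)"
proof -
  define K where "K f = {(M :: (real, 'b) module, ms). \<exists>e. cyclic_presentation M ms e (factors_of f)}" for f
  have "(irreducible_zplus_modules R xs :: ((real, 'b) module \<times> 'b list) set) // zplus_iso_rel R xs
        = K ` placements"
  proof (intro equalityI subsetI)
    fix C assume "C \<in> (irreducible_zplus_modules R xs :: ((real, 'b) module \<times> 'b list) set) // zplus_iso_rel R xs"
    then obtain M :: "(real, 'b) module" and ms where irr: "irreducible_zplus_module R xs M ms"
      and C: "C = zplus_iso_rel R xs `` {(M, ms)}"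
      by (auto simp: irreducible_zplus_modules_def elim!: quotientE)
    obtain e c where pres: "cyclic_presentation M ms e c" and c0: "p 1 dvd c 0"
      using irreducible_presentation[OF irr prime[OF m_pos] p_dvd_d[OF m_pos]] by blast
    obtain f where f: "f \<in> placements" "\<And>k. k < N \<Longrightarrow> factors_of f k = c k"
      using factors_of_surj[of c, OF _ c0] pres unfolding cyclic_presentation_def by blast
    have "C = K f" unfolding C K_def by (rule isomorphism_class_eq[OF presentation_cong[OF pres f(2)]])
    thus "C \<in> K ` placements" using f by blast
  next
    fix C assume "C \<in> K ` placements"
    then obtain f where f: "f \<in> placements" and C: "C = K f" by blast
    obtain M :: "(real, 'b) module" and ms e where pres: "cyclic_presentation M ms e (factors_of f)"
      using presentation_exists[OF inf prod_factors_of[OF f]] by blast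
    have "C = zplus_iso_rel R xs `` {(M, ms)}" unfolding C K_def by (rule isomorphism_class_eq[OF pres, symmetric])
    thus "C \<in> (irreducible_zplus_modules R xs :: ((real, 'b) module \<times> 'b list) set) // zplus_iso_rel R xs"
      using presentation_irreducible[OF pres] by (auto simp: irreducible_zplus_modules_def intro!: quotientI)
  qed
  moreover have "inj_on K placements"
  proof (rule inj_onI)
    fix f g assume f: "f \<in> placements" and g: "g \<in> placements" and eq: "K f = K g"
    obtain M :: "(real, 'b) module" and ms e where pres: "cyclic_presentation M ms e (factors_of f)"
      using presentation_exists[OF inf prod_factors_of[OF f]] by blast
    hence "(M, ms) \<in> K f" unfolding K_def by blast
    hence "(M, ms) \<in> K g" by (simp only: eq)
    then obtain e' where pres': "cyclic_presentation M ms e' (factors_of g)" unfolding K_def by blast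
    obtain s where s: "s < N" "\<And>k. k < N \<Longrightarrow> factors_of g k = factors_of f ((s + k) mod N)"
      using presentation_unique[OF pres pres'] by blast
    have "p 1 dvd factors_of g 0" using p_dvd_factors_of[OF m_pos] placements_1[OF g] by simp
    hence "p 1 dvd factors_of f s" using s(2)[OF N0] s(1) by simp
    hence "s = 0" using p_dvd_factors_of[OF m_pos] placements_1[OF f] by simp
    hence same: "factors_of g k = factors_of f k" if "k < N" for k using s(2)[OF that] that by simp
    show "f = g"
    proof (rule PiE_ext)
      show "f \<in> (\<Pi>\<^sub>E i\<in>{1..m}. if i = 1 then {0} else {..<N})" "g \<in> (\<Pi>\<^sub>E i\<in>{1..m}. if i = 1 then {0} else {..<N})"
        using f g by (simp_all only: placements_def)
      fix i assume i: "i \<in> {1..m}"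
      have "p i dvd factors_of g (f i)"
        using same[OF placements_less[OF f i]] p_dvd_factors_of[OF i, of f "f i"] by simp
      thus "f i = g i" using p_dvd_factors_of[OF i] by simp
    qed
  qed
  ultimately show ?thesis by (simp add: card_image card_placements)
qed

end

theorem corollary3p10:
  fixes d N m :: nat and p :: "nat \<Rightarrow> nat"
  assumes "\<And>i. i \<in> {1..m} \<Longrightarrow> prime (p i)"
    and "inj_on p {1..m}"
    and "d = (\<Prod>i=1..m. p i)"
    and "d \<ge> 2"
    and "N \<ge> 2"
  shows "(\<forall>(M :: (real, 'a) module) ms.
            irreducible_zplus_module (root_ring d N) (root_basis d N) M ms \<longrightarrow>
            (\<exists>c. (\<forall>i\<in>{1..N}. 0 < c i \<and> c i dvd d) \<and> (\<Prod>i=1..N. c i) = d \<and>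
                 zplus_isomorphic (root_ring d N) (root_basis d N) M ms
                   (L_module N c) (L_basis N c))) \<and>
         (infinite (UNIV :: 'a set) \<longrightarrow>
            card ((irreducible_zplus_modules (root_ring d N) (root_basis d N)
                     :: ((real, 'a) module \<times> 'a list) set)
                  // zplus_iso_rel (root_ring d N) (root_basis d N)) = N ^ (m - 1))"
proof -
  interpret factored_root d N m p
    using assms by unfold_locales auto
  show ?thesis using irreducible_isomorphic_L_module card_isomorphism_classes by blast
qed

end
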